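(* Let $n\ge1$ and let $E$ be a pluripolar set in $\mathbb{P}^n$. Define $$E^{(0)}:=\{Z\in\mathbb{P}^n:\ \sigma(Z,s,E)=0\ \text{ for each } s>0\}.$$ Then $E^{(0)}$ is the complement in $\mathbb{P}^n$ of the pluripolar hull $E^*$.
   Context: Let $\omega:=dd^c\log|Z|=\frac{i}{2\pi}\partial\bar\partial\log(|Z_0|^2+\cdots+|Z_n|^2)$ be the Fubini–Study form on complex projective space $\mathbb{P}^n$, where $d^c=\frac{i}{2\pi}(\bar\partial-\partial)$. A function $\varphi:\mathbb{P}^n\to\mathbb{R}\cup\{-\infty\}$ is $\omega$-plurisubharmonic if $\varphi+\psi$ is plurisubharmonic on $U$ for each open $U\subset\mathbb{P}^n$ and each $C^\infty$ function $\psi$ on $U$ with $dd^c\psi=\omega$; the constant $-\infty$ is considered both plurisubharmonic and $\omega$-plurisubharmonic. $\mathrm{PSH}_\omega(\mathbb{P}^n)$ is the set of all such $\varphi$. A set $E\subset\mathbb{P}^n$ is pluripolar if there is $\varphi\in\mathrm{PSH}_\omega(\mathbb{P}^n)$, $\varphi\not\equiv-\infty$, with $E\subset\{\varphi=-\infty\}$. The pluripolar hull of a pluripolar set $E$ is $E^*=\bigcap\{Z\in\mathbb{P}^n:\varphi(Z)=-\infty\}$, the intersection being over all $\varphi\in\mathrm{PSH}_\omega(\mathbb{P}^n)$ that are $-\infty$ on $E$. For $E\subset\mathbb{P}^n$, $Z\in\mathbb{P}^n$, $s\ge0$, the relative $\omega$-plurisubharmonic extremal function is $\sigma(Z,s,E)=\sup\{\varphi(Z):\varphi\in\mathrm{PSH}_\omega(\mathbb{P}^n),\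 \varphi\le -s\chi_E\}$, where $\chi_E$ is the characteristic function of $E$. *)

theory Defs
  imports "HOL-Analysis.Analysis"
begin

section \<open>Complex projective space\<close>

text \<open>
  The type \<open>'n cproj\<close> is the projective space of dimension \<open>n = CARD('n) \<ge> 1\<close>. The \<open>n + 1\<close>
  homogeneous coordinates are indexed by \<open>'n option\<close>, with \<open>None\<close> in the role of the index 0.
\<close>

definition proportional :: "complex ^ ('n::finite option) \<Rightarrow> complex ^ ('n option) \<Rightarrow> bool" where
  "proportional Z W \<longleftrightarrow> Z \<noteq> 0 \<and> W \<noteq> 0 \<and> (\<exists>c. c \<noteq> 0 \<and> W = c *s Z)"

lemma proportional_sym: "proportional Z W \<Longrightarrow> proportional W Z"
  unfolding proportional_def
proof (elim conjE exE, intro conjI)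
  fix c assume "c \<noteq> 0" "W = c *s Z"
  then have "inverse c \<noteq> 0 \<and> Z = inverse c *s W"
    by (simp add: vector_smult_assoc)
  then show "\<exists>c. c \<noteq> 0 \<and> Z = c *s W" by blast
qed auto

lemma proportional_trans: "proportional X Y \<Longrightarrow> proportional Y Z \<Longrightarrow> proportional X Z"
  unfolding proportional_def
  by (auto simp: vector_smult_assoc)

quotient_type (overloaded) 'n cproj = "complex ^ (('n::finite) option)" / partial: proportional
  morphisms homogeneous_rep proj_pt
proof (rule part_equivpI)
  have "proportional (axis None 1) (axis None 1)"
    unfolding proportional_def by (auto simp: axis_eq_0_iff intro!: exI[of _ 1])
  then show "\<exists>Z::complex ^ ('n option). proportional Z Z" by blast
qed (auto intro!: sympI transpI intro: proportional_sym proportional_trans)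

text \<open>Quotient topology of the projection from \<open>complex ^ ('n option)\<close> without the origin.\<close>

instantiation cproj :: (finite) topological_space
begin

definition open_cproj :: "'a cproj set \<Rightarrow> bool" where
  "open_cproj U \<longleftrightarrow> open {Z. Z \<noteq> 0 \<and> proj_pt Z \<in> U}"

instance
proof
  have "open {Z::complex ^ ('a option). Z \<noteq> 0}"
    by (simp add: open_Collect_neq)
  then show "open (UNIV :: 'a cproj set)"
    by (simp add: open_cproj_def)
next
  fix S T :: "'a cproj set"
  assume "open S" "open T"
  then have "open ({Z. Z \<noteq> 0 \<and> proj_pt Z \<in> S} \<inter> {Z. Z \<noteq> 0 \<and> proj_pt Z \<in> T})"
    unfolding open_cproj_def by (rule open_Int)
  moreover have "{Z. Z \<noteq> 0 \<and> proj_pt Z \<in> S} \<inter> {Z. Z \<noteq> 0 \<and> proj_pt Z \<in> T} =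
      {Z. Z \<noteq> 0 \<and> proj_pt Z \<in> S \<inter> T}"
    by auto
  ultimately show "open (S \<inter> T)"
    unfolding open_cproj_def by simp
next
  fix K :: "'a cproj set set"
  assume "\<forall>S\<in>K. open S"
  then have "open (\<Union>S\<in>K. {Z. Z \<noteq> 0 \<and> proj_pt Z \<in> S})"
    unfolding open_cproj_def by blast
  moreover have "(\<Union>S\<in>K. {Z. Z \<noteq> 0 \<and> proj_pt Z \<in> S}) = {Z. Z \<noteq> 0 \<and> proj_pt Z \<in> \<Union>K}"
    by auto
  ultimately show "open (\<Union>K)"
    unfolding open_cproj_def by simp
qed

end

text \<open>
  The affine chart on the set where the \<open>j\<close>-th homogeneous coordinate is nonzero: \<open>affine_lift j z\<close>
  has \<open>j\<close>-th coordinate 1 and its other coordinates are those of \<open>z\<close>. When \<open>j = Some l\<close>, the slot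
  \<open>l\<close> of \<open>z\<close> is free and holds the coordinate of index \<open>None\<close>.
\<close>

definition affine_lift :: "'n option \<Rightarrow> complex ^ 'n \<Rightarrow> complex ^ ('n::finite option)" where
  "affine_lift j z =
     (\<chi> i. if i = j then 1 else (case i of None \<Rightarrow> z $ the j | Some k \<Rightarrow> z $ k))"

definition chart :: "'n option \<Rightarrow> complex ^ 'n \<Rightarrow> 'n::finite cproj" where
  "chart j z = proj_pt (affine_lift j z)"

section \<open>Plurisubharmonic functions\<close>

text \<open>
  Functions with values in \<open>[-\<infinity>, \<infinity>)\<close> are functions into \<^typ>\<open>ereal\<close> that omit \<open>\<infinity>\<close>. The
  constant \<open>-\<infinity>\<close> is subharmonic and plurisubharmonic under the definitions below.
\<close>

definition usc_on :: "'a::topological_space set \<Rightarrow> ('a \<Rightarrow> ereal) \<Rightarrow> bool" where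
  "usc_on S u \<longleftrightarrow> (\<forall>c. openin (top_of_set S) {x \<in> S. u x < c})"

text \<open>
  Mean value over a circle, as the difference of the integrals of the positive and the negative
  part (\<^const>\<open>e2ennreal\<close> sends negative values to 0). For upper semicontinuous \<open>v < \<infinity>\<close> the first
  integral is finite, so \<open>\<infinity> - \<infinity>\<close> does not occur.
\<close>

definition circle_mean :: "(complex \<Rightarrow> ereal) \<Rightarrow> complex \<Rightarrow> real \<Rightarrow> ereal" where
  "circle_mean v a r =
     (enn2ereal (\<integral>\<^sup>+\<theta>\<in>{0..2 * pi}. e2ennreal (v (a + of_real r * cis \<theta>)) \<partial>lborel)
      - enn2ereal (\<integral>\<^sup>+\<theta>\<in>{0..2 * pi}. e2ennreal (- v (a + of_real r * cis \<theta>)) \<partial>lborel))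
     / ereal (2 * pi)"

definition subharmonic_on :: "complex set \<Rightarrow> (complex \<Rightarrow> ereal) \<Rightarrow> bool" where
  "subharmonic_on D v \<longleftrightarrow>
     usc_on D v \<and> (\<forall>a\<in>D. v a \<noteq> \<infinity>) \<and>
     (\<forall>a r. r > 0 \<longrightarrow> cball a r \<subseteq> D \<longrightarrow> v a \<le> circle_mean v a r)"

definition psh_on :: "(complex ^ 'n::finite) set \<Rightarrow> (complex ^ 'n \<Rightarrow> ereal) \<Rightarrow> bool" where
  "psh_on \<Omega> u \<longleftrightarrow>
     usc_on \<Omega> u \<and> (\<forall>z\<in>\<Omega>. u z \<noteq> \<infinity>) \<and>
     (\<forall>a b. subharmonic_on {\<zeta>. a + \<zeta> *s b \<in> \<Omega>} (\<lambda>\<zeta>. u (a + \<zeta> *s b)))"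

definition cproj_psh_on :: "'n::finite cproj set \<Rightarrow> ('n cproj \<Rightarrow> ereal) \<Rightarrow> bool" where
  "cproj_psh_on U u \<longleftrightarrow> (\<forall>j. psh_on (chart j -` U) (u \<circ> chart j))"

section \<open>Smooth functions and \<open>dd\<^sup>c\<close>\<close>

text \<open>On an open set \<open>S\<close>, class \<open>C^k\<close> by iterated directional derivatives.\<close>

primrec Ck_on :: "nat \<Rightarrow> 'a::real_normed_vector set \<Rightarrow> ('a \<Rightarrow> real) \<Rightarrow> bool" where
  "Ck_on 0 S f \<longleftrightarrow> continuous_on S f"
| "Ck_on (Suc k) S f \<longleftrightarrow>
     (\<forall>x\<in>S. f differentiable (at x)) \<and>
     (\<forall>v. Ck_on k S (\<lambda>x. frechet_derivative f (at x) v))"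

definition smooth_on :: "'a::real_normed_vector set \<Rightarrow> ('a \<Rightarrow> real) \<Rightarrow> bool" where
  "smooth_on S f \<longleftrightarrow> (\<forall>k. Ck_on k S f)"

definition cproj_smooth_on :: "'n::finite cproj set \<Rightarrow> ('n cproj \<Rightarrow> real) \<Rightarrow> bool" where
  "cproj_smooth_on U \<psi> \<longleftrightarrow> (\<forall>j. smooth_on (chart j -` U) (\<psi> \<circ> chart j))"

text \<open>
  A complex-valued differential 1-form on an open subset of \<open>complex ^ 'n\<close> is a function of the
  base point and one tangent vector; a 2-form takes two tangent vectors. \<open>del\<close> and \<open>delbar\<close> are the
  complex-linear and the conjugate-linear part of the real differential of \<open>u\<close>, and \<open>ext_deriv\<close> is
  the exterior derivative of a 1-form.
\<close>

definition del :: "(complex ^ 'n \<Rightarrow> real) \<Rightarrow> complex ^ 'n \<Rightarrow> complex ^ 'n::finite \<Rightarrow> complex" where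
  "del u z v =
     (of_real (frechet_derivative u (at z) v) - \<i> * of_real (frechet_derivative u (at z) (\<i> *s v))) / 2"

definition delbar :: "(complex ^ 'n \<Rightarrow> real) \<Rightarrow> complex ^ 'n \<Rightarrow> complex ^ 'n::finite \<Rightarrow> complex" where
  "delbar u z v =
     (of_real (frechet_derivative u (at z) v) + \<i> * of_real (frechet_derivative u (at z) (\<i> *s v))) / 2"

definition dc :: "(complex ^ 'n \<Rightarrow> real) \<Rightarrow> complex ^ 'n \<Rightarrow> complex ^ 'n::finite \<Rightarrow> complex" where
  "dc u z v = \<i> / (2 * of_real pi) * (delbar u z v - del u z v)"

definition ext_deriv ::
  "(complex ^ 'n \<Rightarrow> complex ^ 'n \<Rightarrow> complex) \<Rightarrow>
   complex ^ 'n \<Rightarrow> complex ^ 'n \<Rightarrow> complex ^ 'n::finite \<Rightarrow> complex" where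
  "ext_deriv \<alpha> z v w =
     frechet_derivative (\<lambda>x. \<alpha> x w) (at z) v - frechet_derivative (\<lambda>x. \<alpha> x v) (at z) w"

definition ddc ::
  "(complex ^ 'n \<Rightarrow> real) \<Rightarrow> complex ^ 'n \<Rightarrow> complex ^ 'n \<Rightarrow> complex ^ 'n::finite \<Rightarrow> complex" where
  "ddc u = ext_deriv (dc u)"

text \<open>
  The Fubini--Study form \<open>dd\<^sup>c log |Z|\<close> in the affine chart \<open>j\<close>. On overlaps of charts the lifts
  \<open>Z\<close> differ by a nonvanishing holomorphic factor, so these expressions define one form.
\<close>

definition fubini_study ::
  "'n option \<Rightarrow> complex ^ 'n \<Rightarrow> complex ^ 'n \<Rightarrow> complex ^ 'n::finite \<Rightarrow> complex" where
  "fubini_study j = ddc (\<lambda>z. ln (norm (affine_lift j z)))"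

definition ddc_eq_fubini_study_on :: "'n::finite cproj set \<Rightarrow> ('n cproj \<Rightarrow> real) \<Rightarrow> bool" where
  "ddc_eq_fubini_study_on U \<psi> \<longleftrightarrow>
     (\<forall>j. \<forall>z \<in> chart j -` U. ddc (\<psi> \<circ> chart j) z = fubini_study j z)"

section \<open>\<open>\<omega>\<close>-plurisubharmonic functions\<close>

definition PSH_omega :: "('n::finite cproj \<Rightarrow> ereal) set" where
  "PSH_omega =
     {\<phi>. (\<forall>Z. \<phi> Z \<noteq> \<infinity>) \<and>
         (\<forall>U \<psi>. open U \<longrightarrow> cproj_smooth_on U \<psi> \<longrightarrow> ddc_eq_fubini_study_on U \<psi> \<longrightarrow>
                cproj_psh_on U (\<lambda>Z. \<phi> Z + ereal (\<psi> Z)))}"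

definition pluripolar :: "'n::finite cproj set \<Rightarrow> bool" where
  "pluripolar E \<longleftrightarrow> (\<exists>\<phi>\<in>PSH_omega. (\<exists>Z. \<phi> Z \<noteq> -\<infinity>) \<and> E \<subseteq> {Z. \<phi> Z = -\<infinity>})"

definition pluripolar_hull :: "'n::finite cproj set \<Rightarrow> 'n cproj set" where
  "pluripolar_hull E = (\<Inter>\<phi>\<in>{\<phi>\<in>PSH_omega. \<forall>Z\<in>E. \<phi> Z = -\<infinity>}. {Z. \<phi> Z = -\<infinity>})"

definition extremal_sigma :: "'n::finite cproj \<Rightarrow> real \<Rightarrow> 'n cproj set \<Rightarrow> ereal" where
  "extremal_sigma Z s E =
     (SUP \<phi>\<in>{\<phi>\<in>PSH_omega. \<forall>W. \<phi> W \<le> ereal (- s * indicator E W)}. \<phi> Z)"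

end

theory Submission
  imports Defs
begin

text \<open>
  A point \<open>Z\<close> lies outside the pluripolar hull of \<open>E\<close> iff some \<open>\<omega>\<close>-plurisubharmonic \<open>\<phi>\<close> is \<open>-\<infinity>\<close> on \<open>E\<close> but
  not at \<open>Z\<close>. Such a \<open>\<phi>\<close> is bounded above because the projective space is compact, and may be taken
  nonpositive; the functions \<open>t \<phi>\<close> for small \<open>t > 0\<close> then lie below \<open>- s \<chi>\<^sub>E\<close> for every \<open>s\<close> and tend to 0
  at \<open>Z\<close>, so the extremal function vanishes there (\<open>extremal_sigma_eq_0\<close>). Conversely, if
  \<open>\<sigma>(Z, 2\<^sup>k\<^sup>+\<^sup>1, E) = 0\<close> for all \<open>k\<close>, one picks competitors \<open>\<phi>\<^sub>k\<close> with \<open>\<phi>\<^sub>k Z > -1\<close>; the sum of the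
  \<open>2\<^sup>-\<^sup>k\<^sup>-\<^sup>1 \<phi>\<^sub>k\<close> is \<open>-\<infinity>\<close> on \<open>E\<close> and at least \<open>-1\<close> at \<open>Z\<close> (\<open>separating_PSH_omega\<close>).

  These arguments rest on three properties of the class of \<open>\<omega>\<close>-plurisubharmonic functions. It is
  closed under decreasing limits (\<open>PSH_omega_INF\<close>): the circle mean of \<open>v \<le> C\<close> is \<open>C\<close> minus the mean
  of the nonnegative function \<open>C - v\<close>, to which monotone convergence applies. It is closed under
  combinations with nonnegative weights of total at most 1 (\<open>PSH_omega_subconvex_sum\<close>): by adding the
  share of the potential that the weights leave out, this reduces to the cone property of
  plurisubharmonic functions and to the fact that local potentials of \<open>\<omega>\<close> are plurisubharmonic. The
  latter holds because \<open>\<omega>\<close> is nonnegative on complex lines (\<open>fubini_study_nonneg\<close>) and because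
  functions with nonnegative Laplacian satisfy the submean inequality (\<open>circle_integral_submean\<close>).
  Finally, its members are bounded above (\<open>PSH_omega_bounded_above\<close>): the potential
  \<open>log (|Z| / |Z\<^sub>j|)\<close> on the chart \<open>Z\<^sub>j \<noteq> 0\<close> turns \<open>\<phi>\<close> into an upper semicontinuous function there, and
  finitely many compact polydiscs cover the projective space.
\<close>

section \<open>Upper semicontinuous functions\<close>

lemma usc_on_const: "usc_on S (\<lambda>x. c)"
  unfolding usc_on_def
proof
  fix d show "openin (top_of_set S) {x \<in> S. c < d}"
    by (cases "c < d") auto
qed

text \<open>
  A sum lies below a real \<open>r\<close> iff the two summands lie below \<open>q\<close> and \<open>r - q\<close> for some real \<open>q\<close>, so
  its sublevel sets are unions of intersections of sublevel sets of the summands.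
\<close>

lemma usc_on_add:
  assumes u: "usc_on S u" and v: "usc_on S v"
    and fin: "\<And>x. x \<in> S \<Longrightarrow> u x \<noteq> \<infinity>" "\<And>x. x \<in> S \<Longrightarrow> v x \<noteq> \<infinity>"
  shows "usc_on S (\<lambda>x. u x + v x)"
  unfolding usc_on_def
proof
  fix c :: ereal
  show "openin (top_of_set S) {x \<in> S. u x + v x < c}"
  proof (cases c)
    case (real r)
    have "{x \<in> S. u x + v x < c} = (\<Union>q. {x \<in> S. u x < ereal q} \<inter> {x \<in> S. v x < ereal (r - q)})"
      (is "?L = ?R")
    proof
      show "?L \<subseteq> ?R"
      proof
        fix x assume "x \<in> ?L"
        then have x: "x \<in> S" "u x + v x < ereal r" using real by auto
        have "\<exists>q. u x < ereal q \<and> v x < ereal (r - q)"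
        proof (cases "v x")
          case (real b)
          then have "u x < ereal (r - b)"
            using x(2) by (cases "u x") auto
          then obtain q where "u x < ereal q" "ereal q < ereal (r - b)"
            using ereal_dense2 by blast
          then show ?thesis using real by (intro exI[of _ q]) auto
        next
          case PInf
          then show ?thesis using fin x by auto
        next
          case MInf
          obtain q where "u x < ereal q"
            using fin(1)[OF x(1)] ereal_dense2[of "u x" \<infinity>] by (auto simp: less_top[symmetric] top_ereal_def)
          then show ?thesis using MInf by auto
        qed
        then show "x \<in> ?R" using x(1) by auto
      qed
      show "?R \<subseteq> ?L"
      proof
        fix x assume "x \<in> ?R"
        then obtain q where "x \<in> S" "u x < ereal q" "v x < ereal (r - q)" by auto
        then show "x \<in> ?L" using real by (cases "u x"; cases "v x") auto
      qed
    qed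
    then show ?thesis
      using u v unfolding usc_on_def by (auto intro!: openin_Union)
  next
    case PInf
    then have "{x \<in> S. u x + v x < c} = S"
      using fin by (auto simp: less_top[symmetric] top_ereal_def[symmetric])
        (metis ereal_plus_eq_PInfty top_ereal_def)
    then show ?thesis by simp
  next
    case MInf
    then show ?thesis by simp
  qed
qed

lemma usc_on_mult_pos:
  assumes u: "usc_on S u" and t: "t > 0"
  shows "usc_on S (\<lambda>x. ereal t * u x)"
  unfolding usc_on_def
proof
  fix c :: ereal
  have "ereal t * u x < c \<longleftrightarrow> u x < c / ereal t" for x
    using t by (simp add: ereal_less_divide_pos mult.commute)
  then show "openin (top_of_set S) {x \<in> S. ereal t * u x < c}"
    using u by (simp add: usc_on_def)
qed

lemma usc_on_INF:
  assumes "\<And>k::nat. usc_on S (u k)"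
  shows "usc_on S (\<lambda>x. INF k. u k x)"
  unfolding usc_on_def
proof
  fix c :: ereal
  have "{x \<in> S. (INF k. u k x) < c} = (\<Union>k. {x \<in> S. u k x < c})"
    by (auto simp: INF_less_iff)
  then show "openin (top_of_set S) {x \<in> S. (INF k. u k x) < c}"
    using assms by (auto simp: usc_on_def intro!: openin_Union)
qed

lemma usc_on_continuous:
  assumes "continuous_on S f"
  shows "usc_on S (\<lambda>x. ereal (f x))"
  unfolding usc_on_def
proof
  fix c :: ereal
  have "continuous_on S (\<lambda>x. ereal (f x))"
    using assms by (intro continuous_on_ereal)
  from continuous_openin_preimage[OF this, of UNIV "{..<c}"]
  show "openin (top_of_set S) {x \<in> S. ereal (f x) < c}"
    by (simp add: Collect_conj_eq vimage_def)
qed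

lemma usc_on_compose:
  assumes u: "usc_on S u" and g: "continuous_on T g" "g ` T \<subseteq> S"
  shows "usc_on T (\<lambda>x. u (g x))"
  unfolding usc_on_def
proof
  fix c :: ereal
  have "openin (top_of_set T) (T \<inter> g -` {x \<in> S. u x < c})"
    using continuous_openin_preimage[OF g(1), of S "{x \<in> S. u x < c}"] u g(2)
    by (auto simp: usc_on_def)
  also have "T \<inter> g -` {x \<in> S. u x < c} = {x \<in> T. u (g x) < c}"
    using g(2) by auto
  finally show "openin (top_of_set T) {x \<in> T. u (g x) < c}" .
qed

lemma usc_on_bounded_above:
  fixes S :: "'a::topological_space set"
  assumes u: "usc_on S u" and fin: "\<And>x. x \<in> S \<Longrightarrow> u x \<noteq> \<infinity>"
    and K: "compact K" "K \<subseteq> S"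
  obtains C :: real where "C \<ge> 0" "\<And>x. x \<in> K \<Longrightarrow> u x \<le> ereal C"
proof -
  have "\<forall>n::nat. \<exists>T. open T \<and> {x \<in> S. u x < ereal n} = T \<inter> S"
    using u by (auto simp: usc_on_def openin_subtopology)
  then have "\<exists>T::nat \<Rightarrow> 'a set. \<forall>n. open (T n) \<and> {x \<in> S. u x < ereal n} = T n \<inter> S"
    by (rule choice[where Q = "\<lambda>n T. open T \<and> {x \<in> S. u x < ereal (real n)} = T \<inter> S"])
  then obtain T :: "nat \<Rightarrow> 'a set" where T0: "\<forall>n. open (T n) \<and> {x \<in> S. u x < ereal n} = T n \<inter> S" ..
  have T: "open (T n)" "{x \<in> S. u x < ereal n} = T n \<inter> S" for n
    using T0 by simp_all
  have "\<exists>n. x \<in> T n" if "x \<in> K" for x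
  proof -
    have "u x \<noteq> \<infinity>" using fin that K by auto
    then obtain n :: nat where "u x < ereal n"
      by (cases "u x") (use reals_Archimedean2 in auto)
    then show ?thesis using T(2)[of n] that K by blast
  qed
  then have "K \<subseteq> (\<Union>n\<in>UNIV. T n)" by blast
  with K(1) T(1) obtain N where N: "finite N" "K \<subseteq> (\<Union>n\<in>N. T n)"
    by (rule compactE_image[where C = UNIV])
  show ?thesis
  proof
    show "0 \<le> real (Max (insert 0 N))" by (rule of_nat_0_le_iff)
    fix x assume "x \<in> K"
    then obtain n where n: "n \<in> N" "x \<in> T n" using N by blast
    then have "u x < ereal n" using T(2)[of n] \<open>x \<in> K\<close> K by blast
    also have "ereal n \<le> ereal (Max (insert 0 N))"
      using Max_ge[of "insert 0 N" n] n(1) N(1) by simp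
    finally show "u x \<le> ereal (Max (insert 0 N))" by (rule less_imp_le)
  qed
qed

section \<open>Circle means\<close>

text \<open>
  The integral of the single nonnegative function \<open>C - v\<close> has additivity, homogeneity and monotone
  convergence at hand, none of which is visible in the difference \<open>P - N\<close> of the integrals of the
  positive and the negative part. As \<open>C \<ge> 0\<close>, the positive part satisfies \<open>0 \<le> v\<^sup>+ \<le> C\<close>, so \<open>P\<close> is finite
  and \<open>P - N = 2 \<pi> C - (A + N)\<close>, where \<open>A\<close> is the integral of \<open>C - v\<^sup>+\<close>.
\<close>

lemma circle_mean_eq:
  assumes meas: "(\<lambda>\<theta>. v (a + of_real r * cis \<theta>)) \<in> borel_measurable lborel"
    and C: "C \<ge> 0" "\<And>\<theta>. v (a + of_real r * cis \<theta>) \<le> ereal C"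
  shows "circle_mean v a r =
    (ereal (2 * pi * C) -
      enn2ereal (\<integral>\<^sup>+\<theta>\<in>{0..2 * pi}. e2ennreal (ereal C - v (a + of_real r * cis \<theta>)) \<partial>lborel))
    / ereal (2 * pi)"
proof -
  let ?I = "{0..2 * pi}"
  define f where "f \<theta> = v (a + of_real r * cis \<theta>)" for \<theta>
  have f[measurable]: "f \<in> borel_measurable lborel"
    using meas by (simp add: f_def[abs_def])
  have fC: "f \<theta> \<le> ereal C" for \<theta> using C(2) by (simp add: f_def)
  define P where "P = (\<integral>\<^sup>+\<theta>\<in>?I. e2ennreal (f \<theta>) \<partial>lborel)"
  define N where "N = (\<integral>\<^sup>+\<theta>\<in>?I. e2ennreal (- f \<theta>) \<partial>lborel)"
  define A where "A = (\<integral>\<^sup>+\<theta>\<in>?I. e2ennreal (ereal C - max 0 (f \<theta>)) \<partial>lborel)"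
  define T where "T = (\<integral>\<^sup>+\<theta>\<in>?I. e2ennreal (ereal C - f \<theta>) \<partial>lborel)"
  have nonneg: "0 \<le> ereal C - max 0 (f \<theta>)" for \<theta>
    using fC[of \<theta>] C(1) by (cases "f \<theta>") (auto simp: max_def)
  have "P + A = (\<integral>\<^sup>+\<theta>\<in>?I. ennreal C \<partial>lborel)"
    unfolding P_def A_def
  proof (subst nn_integral_add[symmetric], goal_cases)
    case 3
    have "e2ennreal (f \<theta>) + e2ennreal (ereal C - max 0 (f \<theta>)) = ennreal C" for \<theta>
    proof -
      have "e2ennreal (f \<theta>) = e2ennreal (max 0 (f \<theta>))"
        by (cases "f \<theta> \<le> 0") (auto simp: max_def e2ennreal_neg)
      then have "e2ennreal (f \<theta>) + e2ennreal (ereal C - max 0 (f \<theta>))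
          = e2ennreal (max 0 (f \<theta>) + (ereal C - max 0 (f \<theta>)))"
        using nonneg by (simp add: plus_ennreal.abs_eq eq_onp_def)
      also have "max 0 (f \<theta>) + (ereal C - max 0 (f \<theta>)) = ereal C"
        using fC[of \<theta>] C(1) by (cases "f \<theta>") (auto simp: max_def)
      finally show ?thesis using C(1) by simp
    qed
    then show ?case by (intro nn_integral_cong) (auto simp: indicator_def)
  qed auto
  also have "\<dots> = ennreal (2 * pi * C)"
    using C(1) by (simp add: nn_integral_cmult_indicator ennreal_mult' mult.commute)
  finally have PA: "P + A = ennreal (2 * pi * C)" .
  have TAN: "T = A + N"
    unfolding T_def A_def N_def
  proof (subst nn_integral_add[symmetric], goal_cases)
    case 3
    have "e2ennreal (ereal C - f \<theta>) = e2ennreal (ereal C - max 0 (f \<theta>)) + e2ennreal (- f \<theta>)" for \<theta>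
    proof -
      have "e2ennreal (- f \<theta>) = e2ennreal (max 0 (- f \<theta>))"
        by (cases "- f \<theta> \<le> 0") (auto simp: max_def e2ennreal_neg)
      moreover have "ereal C - f \<theta> = (ereal C - max 0 (f \<theta>)) + max 0 (- f \<theta>)"
        using fC[of \<theta>] C(1) by (cases "f \<theta>") (auto simp: max_def)
      ultimately show ?thesis
          using nonneg by (simp add: plus_ennreal.abs_eq eq_onp_def)
    qed
    then show ?case by (intro nn_integral_cong) (auto simp: indicator_def)
  qed auto
  have "P \<noteq> \<infinity>" "A \<noteq> \<infinity>" using PA by auto
  then obtain p q where pq: "P = ennreal p" "A = ennreal q" "p \<ge> 0" "q \<ge> 0"
    by (cases P; cases A) auto
  then have sum: "p + q = 2 * pi * C"
    using PA C(1) by (metis add_nonneg_nonneg ennreal_inj ennreal_plus mult_nonneg_nonneg pi_ge_zero zero_le_numeral)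
  have "enn2ereal P - enn2ereal N = ereal (2 * pi * C) - enn2ereal T"
  proof (cases N)
    case (real n)
    then have "T = ennreal (q + n)" using TAN pq by (simp add: ennreal_plus)
    then have "enn2ereal T = ereal (q + n)" 
      using pq real by (simp del: ennreal_plus)
    then show ?thesis using pq sum[symmetric] real by simp
  next
    case top
    then show ?thesis using TAN pq by simp
  qed
  then show ?thesis
    unfolding circle_mean_def P_def N_def T_def f_def by simp
qed

text \<open>
  The submean inequality for \<open>v\<close> is the supermean inequality for the nonnegative function \<open>C - v\<close>.
\<close>

lemma le_circle_mean_iff:
  assumes meas: "(\<lambda>\<theta>. v (a + of_real r * cis \<theta>)) \<in> borel_measurable lborel"
    and C: "C \<ge> 0" "\<And>\<theta>. v (a + of_real r * cis \<theta>) \<le> ereal C" "v a \<le> ereal C"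
  shows "v a \<le> circle_mean v a r \<longleftrightarrow>
    (\<integral>\<^sup>+\<theta>\<in>{0..2 * pi}. e2ennreal (ereal C - v (a + of_real r * cis \<theta>)) \<partial>lborel)
      \<le> ennreal (2 * pi) * e2ennreal (ereal C - v a)" (is "_ \<longleftrightarrow> ?T \<le> _")
proof -
  have "circle_mean v a r = (ereal (2 * pi * C) - enn2ereal ?T) / ereal (2 * pi)"
    using meas C by (intro circle_mean_eq)
  then have "v a \<le> circle_mean v a r \<longleftrightarrow> v a * ereal (2 * pi) \<le> ereal (2 * pi * C) - enn2ereal ?T"
    by (simp add: ereal_le_divide_pos mult.commute)
  also have "\<dots> \<longleftrightarrow> ?T \<le> ennreal (2 * pi) * e2ennreal (ereal C - v a)"
  proof (cases "v a")
    case (real x)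
    then have "x \<le> C" using C by simp
    then have *: "ennreal (2 * pi) * e2ennreal (ereal C - v a) = ennreal (2 * pi * (C - x))"
      using real by (simp add: ennreal_mult)
    show ?thesis unfolding * using real \<open>x \<le> C\<close>
      by (cases ?T) (auto simp: algebra_simps top_unique)
  next
    case PInf
    then show ?thesis using C by simp
  next
    case MInf
    then show ?thesis by (simp add: ennreal_mult_top)
  qed
  finally show ?thesis .
qed

section \<open>The cone of plurisubharmonic functions\<close>

lemma circle_in_cball: "r \<ge> 0 \<Longrightarrow> a + of_real r * cis \<theta> \<in> cball a r"
  by (simp add: dist_norm norm_mult)

lemma usc_on_circle_measurable:
  assumes u: "usc_on D u" and r: "r \<ge> 0" "cball a r \<subseteq> D"
  shows "(\<lambda>\<theta>. u (a + of_real r * cis \<theta>)) \<in> borel_measurable lborel"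
proof -
  have "usc_on UNIV (\<lambda>\<theta>. u (a + of_real r * cis \<theta>))"
    by (rule usc_on_compose[OF u])
      (use r circle_in_cball[of r a] in \<open>auto intro!: continuous_intros\<close>)
  then have "open {\<theta>. u (a + of_real r * cis \<theta>) < c}" for c
    by (auto simp: usc_on_def)
  then show ?thesis
    by (intro borel_measurableI_less) auto
qed

text \<open>
  Any single bound \<open>C\<close> on the closed disc suffices to test the submean inequality, and conversely it
  holds in this form for all such bounds (\<open>subharmonic_on_nn_integral_le\<close>). The closure properties
  below need this freedom, since they combine bounds of different functions.
\<close>

lemma subharmonic_onI:
  assumes "usc_on D v" "\<And>z. z \<in> D \<Longrightarrow> v z \<noteq> \<infinity>"
    and "\<And>a r. r > 0 \<Longrightarrow> cball a r \<subseteq> D \<Longrightarrow>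
      \<exists>C\<ge>0. (\<forall>z\<in>cball a r. v z \<le> ereal C) \<and>
        (\<integral>\<^sup>+\<theta>\<in>{0..2 * pi}. e2ennreal (ereal C - v (a + of_real r * cis \<theta>)) \<partial>lborel)
          \<le> ennreal (2 * pi) * e2ennreal (ereal C - v a)"
  shows "subharmonic_on D v"
  unfolding subharmonic_on_def
proof (intro conjI ballI allI impI)
  fix a r assume r: "r > 0" "cball a r \<subseteq> D"
  obtain C where C: "C \<ge> 0" "\<forall>z\<in>cball a r. v z \<le> ereal C"
    and le: "(\<integral>\<^sup>+\<theta>\<in>{0..2 * pi}. e2ennreal (ereal C - v (a + of_real r * cis \<theta>)) \<partial>lborel)
          \<le> ennreal (2 * pi) * e2ennreal (ereal C - v a)"
    using assms(3)[OF r] by blast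
  have "v (a + of_real r * cis \<theta>) \<le> ereal C" for \<theta>
    using C(2) circle_in_cball[of r a \<theta>] r(1) by simp
  moreover have "v a \<le> ereal C" using C(2) r(1) by simp
  ultimately show "v a \<le> circle_mean v a r"
    using le le_circle_mean_iff[of v a r C] C(1) r usc_on_circle_measurable[OF assms(1), of r a]
    by simp
qed (use assms in auto)

lemma subharmonic_on_nn_integral_le:
  assumes v: "subharmonic_on D v" and r: "r > 0" "cball a r \<subseteq> D"
    and C: "C \<ge> 0" "\<forall>z\<in>cball a r. v z \<le> ereal C"
  shows "(\<integral>\<^sup>+\<theta>\<in>{0..2 * pi}. e2ennreal (ereal C - v (a + of_real r * cis \<theta>)) \<partial>lborel)
          \<le> ennreal (2 * pi) * e2ennreal (ereal C - v a)"
proof -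
  have "v (a + of_real r * cis \<theta>) \<le> ereal C" for \<theta>
    using C(2) circle_in_cball[of r a \<theta>] r(1) by simp
  moreover have "v a \<le> ereal C" using C(2) r(1) by simp
  moreover have "usc_on D v" "v a \<le> circle_mean v a r"
    using v r by (auto simp: subharmonic_on_def)
  ultimately show ?thesis
    using le_circle_mean_iff[of v a r C] C(1) r usc_on_circle_measurable[of D v r a]
    by simp
qed

lemma subharmonic_on_bounded_above:
  assumes v: "subharmonic_on D v" and r: "cball a r \<subseteq> D"
  obtains C :: real where "C \<ge> 0" "\<forall>z\<in>cball a r. v z \<le> ereal C"
proof (rule usc_on_bounded_above[of D v "cball a r"])
  show "usc_on D v" "\<And>z. z \<in> D \<Longrightarrow> v z \<noteq> \<infinity>"
    using v by (simp_all add: subharmonic_on_def)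
qed (use r that in auto)

lemma subharmonic_on_const:
  assumes "c \<noteq> \<infinity>"
  shows "subharmonic_on D (\<lambda>z. c)"
proof (rule subharmonic_onI)
  have "\<exists>C\<ge>0. c \<le> ereal C"
    using assms by (cases c) (auto intro!: exI[of _ "max 0 (real_of_ereal c)"])
  then obtain C where C: "C \<ge> 0" "c \<le> ereal C" by blast
  fix a r
  show "\<exists>C\<ge>0. (\<forall>z\<in>cball a r. c \<le> ereal C) \<and>
        (\<integral>\<^sup>+\<theta>\<in>{0..2 * pi}. e2ennreal (ereal C - c) \<partial>lborel)
          \<le> ennreal (2 * pi) * e2ennreal (ereal C - c)"
    by (intro exI[of _ C]) (use C in \<open>auto simp: nn_integral_cmult_indicator mult.commute\<close>)
qed (use assms in \<open>auto intro: usc_on_const\<close>)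

lemma subharmonic_on_add:
  assumes u: "subharmonic_on D u" and v: "subharmonic_on D v"
  shows "subharmonic_on D (\<lambda>z. u z + v z)"
proof (rule subharmonic_onI)
  show "usc_on D (\<lambda>z. u z + v z)"
    using u v unfolding subharmonic_on_def by (intro usc_on_add) auto
  fix a r assume r: "r > (0::real)" "cball a r \<subseteq> D"
  obtain B where B: "B \<ge> 0" "\<forall>z\<in>cball a r. u z \<le> ereal B"
    using subharmonic_on_bounded_above[OF u r(2)] by blast
  obtain C where C: "C \<ge> 0" "\<forall>z\<in>cball a r. v z \<le> ereal C"
    using subharmonic_on_bounded_above[OF v r(2)] by blast
  have split: "e2ennreal (ereal (B + C) - (u z + v z)) =
      e2ennreal (ereal B - u z) + e2ennreal (ereal C - v z)" if "z \<in> cball a r" for z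
  proof -
    have "ereal (B + C) - (u z + v z) = (ereal B - u z) + (ereal C - v z)"
      "ereal B - u z \<ge> 0" "ereal C - v z \<ge> 0"
      using bspec[OF B(2) that] bspec[OF C(2) that]
      by (cases "u z"; cases "v z"; simp; fail)+
    then show ?thesis by (simp add: plus_ennreal.abs_eq eq_onp_def)
  qed
  let ?z = "\<lambda>\<theta>. a + of_real r * cis \<theta>"
  have "(\<integral>\<^sup>+\<theta>\<in>{0..2 * pi}. e2ennreal (ereal (B + C) - (u (?z \<theta>) + v (?z \<theta>))) \<partial>lborel) =
      (\<integral>\<^sup>+\<theta>. e2ennreal (ereal B - u (?z \<theta>)) * indicator {0..2 * pi} \<theta> +
        e2ennreal (ereal C - v (?z \<theta>)) * indicator {0..2 * pi} \<theta> \<partial>lborel)"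
    using r circle_in_cball[of r a] by (intro nn_integral_cong) (simp add: split distrib_right)
  also have "\<dots> = (\<integral>\<^sup>+\<theta>\<in>{0..2 * pi}. e2ennreal (ereal B - u (?z \<theta>)) \<partial>lborel) +
      (\<integral>\<^sup>+\<theta>\<in>{0..2 * pi}. e2ennreal (ereal C - v (?z \<theta>)) \<partial>lborel)"
  proof (rule nn_integral_add)
    have [measurable]: "(\<lambda>\<theta>. u (?z \<theta>)) \<in> borel_measurable lborel"
      "(\<lambda>\<theta>. v (?z \<theta>)) \<in> borel_measurable lborel"
      using usc_on_circle_measurable[of D _ r a] u v r by (auto simp: subharmonic_on_def)
    show "(\<lambda>\<theta>. e2ennreal (ereal B - u (?z \<theta>)) * indicator {0..2 * pi} \<theta>) \<in> borel_measurable lborel"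
      "(\<lambda>\<theta>. e2ennreal (ereal C - v (?z \<theta>)) * indicator {0..2 * pi} \<theta>) \<in> borel_measurable lborel"
      by measurable
  qed
  also have "\<dots> \<le> ennreal (2 * pi) * e2ennreal (ereal B - u a) + ennreal (2 * pi) * e2ennreal (ereal C - v a)"
    by (intro add_mono subharmonic_on_nn_integral_le[OF u r B] subharmonic_on_nn_integral_le[OF v r C])
  also have "\<dots> = ennreal (2 * pi) * e2ennreal (ereal (B + C) - (u a + v a))"
    using r by (simp add: split distrib_left)
  finally show "\<exists>C\<ge>0. (\<forall>z\<in>cball a r. u z + v z \<le> ereal C) \<and>
        (\<integral>\<^sup>+\<theta>\<in>{0..2 * pi}. e2ennreal (ereal C - (u (?z \<theta>) + v (?z \<theta>))) \<partial>lborel)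
          \<le> ennreal (2 * pi) * e2ennreal (ereal C - (u a + v a))"
    using B C add_mono[of "u _" "ereal B" "v _" "ereal C"]
    by (intro exI[of _ "B + C"]) simp
qed (use u v in \<open>auto simp: subharmonic_on_def\<close>)

lemma subharmonic_on_mult_pos:
  assumes u: "subharmonic_on D u" and t: "t > 0"
  shows "subharmonic_on D (\<lambda>z. ereal t * u z)"
proof (rule subharmonic_onI)
  show "usc_on D (\<lambda>z. ereal t * u z)"
    using u t unfolding subharmonic_on_def by (intro usc_on_mult_pos) auto
  fix a r assume r: "r > (0::real)" "cball a r \<subseteq> D"
  obtain B where B: "B \<ge> 0" "\<forall>z\<in>cball a r. u z \<le> ereal B"
    using subharmonic_on_bounded_above[OF u r(2)] by blast
  have scale: "e2ennreal (ereal (t * B) - ereal t * u z) = ennreal t * e2ennreal (ereal B - u z)"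
    if "z \<in> cball a r" for z
  proof -
    have "ereal (t * B) - ereal t * u z = ereal t * (ereal B - u z)" "ereal B - u z \<ge> 0"
      using bspec[OF B(2) that] t by (cases "u z"; simp add: right_diff_distrib; fail)+
    then show ?thesis
      using t by (simp add: times_ennreal.abs_eq eq_onp_def flip: e2ennreal_ereal)
  qed
  let ?z = "\<lambda>\<theta>. a + of_real r * cis \<theta>"
  have [measurable]: "(\<lambda>\<theta>. u (?z \<theta>)) \<in> borel_measurable lborel"
    using usc_on_circle_measurable[of D _ r a] u r by (auto simp: subharmonic_on_def)
  have "(\<integral>\<^sup>+\<theta>\<in>{0..2 * pi}. e2ennreal (ereal (t * B) - ereal t * u (?z \<theta>)) \<partial>lborel) =
      (\<integral>\<^sup>+\<theta>. ennreal t * (e2ennreal (ereal B - u (?z \<theta>)) * indicator {0..2 * pi} \<theta>) \<partial>lborel)"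
    using r circle_in_cball[of r a] by (intro nn_integral_cong) (simp add: scale mult.assoc)
  also have "\<dots> = ennreal t * (\<integral>\<^sup>+\<theta>\<in>{0..2 * pi}. e2ennreal (ereal B - u (?z \<theta>)) \<partial>lborel)"
    by (rule nn_integral_cmult) measurable
  also have "\<dots> \<le> ennreal t * (ennreal (2 * pi) * e2ennreal (ereal B - u a))"
    by (intro mult_left_mono subharmonic_on_nn_integral_le[OF u r B]) auto
  also have "\<dots> = ennreal (2 * pi) * e2ennreal (ereal (t * B) - ereal t * u a)"
    using r by (subst scale) (simp_all add: mult.left_commute)
  finally show "\<exists>C\<ge>0. (\<forall>z\<in>cball a r. ereal t * u z \<le> ereal C) \<and>
        (\<integral>\<^sup>+\<theta>\<in>{0..2 * pi}. e2ennreal (ereal C - ereal t * u (?z \<theta>)) \<partial>lborel)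
          \<le> ennreal (2 * pi) * e2ennreal (ereal C - ereal t * u a)"
    using B t ereal_mult_left_mono[of "u _" "ereal B" "ereal t"]
    by (intro exI[of _ "t * B"]) simp
qed (use u t in \<open>auto simp: subharmonic_on_def\<close>)

text \<open>
  As \<open>u k\<close> decreases, \<open>B - u k\<close> increases with one common bound \<open>B\<close> taken from \<open>u 0\<close>, so this is monotone
  convergence.
\<close>

lemma subharmonic_on_INF:
  assumes u: "\<And>k::nat. subharmonic_on D (u k)" and dec: "\<And>z. z \<in> D \<Longrightarrow> decseq (\<lambda>k. u k z)"
  shows "subharmonic_on D (\<lambda>z. INF k. u k z)"
proof (rule subharmonic_onI)
  show "usc_on D (\<lambda>z. INF k. u k z)"
    using u unfolding subharmonic_on_def by (intro usc_on_INF) auto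
  show "(INF k. u k z) \<noteq> \<infinity>" if "z \<in> D" for z
    using u[of 0] that INF_lower[of 0 UNIV "\<lambda>k. u k z"] by (auto simp: subharmonic_on_def)
  fix a r assume r: "r > (0::real)" "cball a r \<subseteq> D"
  obtain B where B: "B \<ge> 0" "\<forall>z\<in>cball a r. u 0 z \<le> ereal B"
    using subharmonic_on_bounded_above[OF u r(2)] by blast
  have Bk: "\<forall>z\<in>cball a r. u k z \<le> ereal B" for k
  proof
    fix z assume "z \<in> cball a r"
    then have "u k z \<le> u 0 z" "u 0 z \<le> ereal B"
      using dec[of z] r(2) B(2) by (auto simp: decseq_def)
    then show "u k z \<le> ereal B" by (rule order_trans)
  qed
  have sup: "e2ennreal (ereal B - (INF k. u k z)) = (SUP k. e2ennreal (ereal B - u k z))"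
    if "z \<in> cball a r" for z
  proof -
    have "ereal B - (INF k. u k z) = (SUP k. ereal B - u k z)"
      by (simp add: SUP_ereal_minus_right)
    moreover have "mono (\<lambda>k. ereal B - u k z)"
      using dec that r(2) by (auto simp: incseq_def decseq_def intro!: ereal_minus_mono)
    ultimately show ?thesis
      using sup_continuousD[OF sup_continuous_e2ennreal[OF sup_continuous_id]] by simp
  qed
  have mono: "incseq (\<lambda>k. e2ennreal (ereal B - u k z))" if "z \<in> cball a r" for z
    using dec that r(2) by (auto simp: incseq_def decseq_def intro!: e2ennreal_mono ereal_minus_mono)
  let ?z = "\<lambda>\<theta>. a + of_real r * cis \<theta>"
  have [measurable]: "(\<lambda>\<theta>. u k (?z \<theta>)) \<in> borel_measurable lborel" for k
    using usc_on_circle_measurable[of D _ r a] u r by (auto simp: subharmonic_on_def)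
  have "(\<integral>\<^sup>+\<theta>\<in>{0..2 * pi}. e2ennreal (ereal B - (INF k. u k (?z \<theta>))) \<partial>lborel) =
      (\<integral>\<^sup>+\<theta>. (SUP k. e2ennreal (ereal B - u k (?z \<theta>)) * indicator {0..2 * pi} \<theta>) \<partial>lborel)"
    using r circle_in_cball[of r a] by (intro nn_integral_cong) (simp add: sup SUP_mult_right_ennreal)
  also have "\<dots> = (SUP k. (\<integral>\<^sup>+\<theta>\<in>{0..2 * pi}. e2ennreal (ereal B - u k (?z \<theta>)) \<partial>lborel))"
  proof (rule nn_integral_monotone_convergence_SUP)
    show "incseq (\<lambda>k \<theta>. e2ennreal (ereal B - u k (?z \<theta>)) * indicator {0..2 * pi} \<theta>)"
      using mono circle_in_cball[of r a] r
      by (auto simp: incseq_def le_fun_def intro!: mult_right_mono)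
    show "(\<lambda>\<theta>. e2ennreal (ereal B - u k (?z \<theta>)) * indicator {0..2 * pi} \<theta>) \<in> borel_measurable lborel" for k
      by measurable
  qed
  also have "\<dots> \<le> ennreal (2 * pi) * e2ennreal (ereal B - (INF k. u k a))"
    unfolding sup[OF centre_in_cball[THEN iffD2, OF less_imp_le[OF r(1)]]]
    by (intro SUP_least order_trans[OF subharmonic_on_nn_integral_le[OF u r B(1) Bk]] mult_left_mono SUP_upper) auto
  finally show "\<exists>C\<ge>0. (\<forall>z\<in>cball a r. (INF k. u k z) \<le> ereal C) \<and>
        (\<integral>\<^sup>+\<theta>\<in>{0..2 * pi}. e2ennreal (ereal C - (INF k. u k (?z \<theta>))) \<partial>lborel)
          \<le> ennreal (2 * pi) * e2ennreal (ereal C - (INF k. u k a))"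
    using B by (intro exI[of _ B]) (auto intro: INF_lower2)
qed

lemma psh_on_const: "c \<noteq> \<infinity> \<Longrightarrow> psh_on \<Omega> (\<lambda>z. c)"
  by (simp add: psh_on_def usc_on_const subharmonic_on_const)

lemma psh_on_add:
  assumes "psh_on \<Omega> u" "psh_on \<Omega> v"
  shows "psh_on \<Omega> (\<lambda>z. u z + v z)"
  using assms unfolding psh_on_def by (auto intro!: usc_on_add subharmonic_on_add)

lemma psh_on_mult:
  assumes "psh_on \<Omega> u" "t \<ge> 0"
  shows "psh_on \<Omega> (\<lambda>z. ereal t * u z)"
proof (cases "t = 0")
  case True
  then show ?thesis using psh_on_const[of 0 \<Omega>] by (simp flip: zero_ereal_def)
next
  case False
  then show ?thesis
    using assms unfolding psh_on_def by (auto intro!: usc_on_mult_pos subharmonic_on_mult_pos)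
qed

lemma psh_on_INF:
  assumes u: "\<And>k::nat. psh_on \<Omega> (u k)" and dec: "\<And>z. decseq (\<lambda>k. u k z)"
  shows "psh_on \<Omega> (\<lambda>z. INF k. u k z)"
  unfolding psh_on_def
proof (intro conjI ballI allI)
  show "usc_on \<Omega> (\<lambda>z. INF k. u k z)"
    using u by (intro usc_on_INF) (auto simp: psh_on_def)
  show "(INF k. u k z) \<noteq> \<infinity>" if "z \<in> \<Omega>" for z
    using u[of 0] that INF_lower[of 0 UNIV "\<lambda>k. u k z"] by (auto simp: psh_on_def)
  show "subharmonic_on {\<zeta>. a + \<zeta> *s b \<in> \<Omega>} (\<lambda>\<zeta>. INF k. u k (a + \<zeta> *s b))" for a b
    using u dec by (intro subharmonic_on_INF) (auto simp: psh_on_def)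
qed

section \<open>Functions with nonnegative Laplacian\<close>

text \<open>
  Write \<open>M t\<close> for the integral of \<open>w\<close> over the circle of radius \<open>t\<close>, parametrized by the angle. Then
  \<open>t M'(t) = N t\<close>, where \<open>N t\<close> is the flux of the gradient through that circle. By the divergence
  theorem \<open>N\<close> should grow, as \<open>N'(t)\<close> is \<open>t\<close> times the integral of the Laplacian over the circle. In
  polar coordinates this is a direct computation: the integrand \<open>F' t\<close> of \<open>N'(t)\<close> and \<open>t\<close> times the
  Laplacian differ by the angular derivative of the tangential component of the gradient, whose
  integral over the circle vanishes by periodicity. Hence \<open>N \<ge> N 0 = 0\<close>, \<open>M\<close> is nondecreasing, and
  \<open>M 0 \<le> M r\<close> is the claim.
\<close>

lemma circle_integral_submean:
  fixes w P Q Px Py Qx Qy :: "complex \<Rightarrow> real"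
  assumes r: "r > 0" and D: "cball c r \<subseteq> D"
    and dw: "\<And>\<zeta>. \<zeta> \<in> D \<Longrightarrow> (w has_derivative (\<lambda>h. P \<zeta> * Re h + Q \<zeta> * Im h)) (at \<zeta>)"
    and dP: "\<And>\<zeta>. \<zeta> \<in> D \<Longrightarrow> (P has_derivative (\<lambda>h. Px \<zeta> * Re h + Py \<zeta> * Im h)) (at \<zeta>)"
    and dQ: "\<And>\<zeta>. \<zeta> \<in> D \<Longrightarrow> (Q has_derivative (\<lambda>h. Qx \<zeta> * Re h + Qy \<zeta> * Im h)) (at \<zeta>)"
    and cont: "continuous_on D Px" "continuous_on D Py" "continuous_on D Qx" "continuous_on D Qy"
    and laplace: "\<And>\<zeta>. \<zeta> \<in> D \<Longrightarrow> Px \<zeta> + Qy \<zeta> \<ge> 0"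
  shows "2 * pi * w c \<le> integral {0..2 * pi} (\<lambda>\<theta>. w (c + of_real r * cis \<theta>))"
proof -
  define z where "z t \<theta> = c + of_real t * cis \<theta>" for t \<theta>
  have zD: "z t \<theta> \<in> D" if "t \<in> {0..r}" for t \<theta>
  proof -
    have "z t \<theta> \<in> cball c t" using that circle_in_cball[of t c \<theta>] by (simp add: z_def)
    then show ?thesis using that D by auto
  qed
  have cont_w: "continuous_on D w" "continuous_on D P" "continuous_on D Q"
    using dw dP dQ by (meson has_derivative_continuous continuous_at_imp_continuous_on)+
  have zcont: "continuous_on S (\<lambda>x. g (z (\<alpha> x) (\<beta> x)))"
    if "continuous_on D g" "continuous_on S \<alpha>" "continuous_on S \<beta>" "\<And>x. x \<in> S \<Longrightarrow> \<alpha> x \<in> {0..r}"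
    for g :: "complex \<Rightarrow> real" and S :: "'b::topological_space set" and \<alpha> \<beta>
    by (rule continuous_on_compose2[OF that(1)])
      (use that zD in \<open>auto simp: z_def intro!: continuous_intros\<close>)
  note zcont' = zcont[OF cont_w(1)] zcont[OF cont_w(2)] zcont[OF cont_w(3)]
    zcont[OF cont(1)] zcont[OF cont(2)] zcont[OF cont(3)] zcont[OF cont(4)]
  have radial: "((\<lambda>t. g (z t \<theta>)) has_field_derivative gx (z t \<theta>) * cos \<theta> + gy (z t \<theta>) * sin \<theta>)
      (at t within S)"
    if "(g has_derivative (\<lambda>h. gx (z t \<theta>) * Re h + gy (z t \<theta>) * Im h)) (at (z t \<theta>))"
    for g gx gy :: "complex \<Rightarrow> real" and t \<theta> S
  proof -
    have "((\<lambda>t. z t \<theta>) has_derivative (\<lambda>h. of_real h * cis \<theta>)) (at t within S)"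
      unfolding z_def by (auto intro!: derivative_eq_intros)
    from has_derivative_compose[OF this that]
    show ?thesis unfolding has_field_derivative_def
      by (rule has_derivative_eq_rhs) (simp add: fun_eq_iff algebra_simps)
  qed
  have angular: "((\<lambda>\<theta>. g (z t \<theta>)) has_field_derivative
        t * (gy (z t \<theta>) * cos \<theta> - gx (z t \<theta>) * sin \<theta>)) (at \<theta> within S)"
    if "(g has_derivative (\<lambda>h. gx (z t \<theta>) * Re h + gy (z t \<theta>) * Im h)) (at (z t \<theta>))"
    for g gx gy :: "complex \<Rightarrow> real" and t \<theta> S
  proof -
    have "((\<lambda>\<theta>. z t \<theta>) has_derivative (\<lambda>h. of_real (t * h) * (\<i> * cis \<theta>))) (at \<theta> within S)"
      unfolding z_def by (auto intro!: derivative_eq_intros simp: scaleR_conv_of_real mult_ac)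
    from has_derivative_compose[OF this that]
    show ?thesis unfolding has_field_derivative_def
      by (rule has_derivative_eq_rhs) (simp add: fun_eq_iff algebra_simps)
  qed
  note radial_P = radial[of P Px _ _ Py, OF dP] and radial_Q = radial[of Q Qx _ _ Qy, OF dQ]
    and angular_P = angular[of P Px _ _ Py, OF dP] and angular_Q = angular[of Q Qx _ _ Qy, OF dQ]
  define M where "M t = integral (cbox 0 (2 * pi)) (\<lambda>\<theta>. w (z t \<theta>))" for t
  define F where "F t \<theta> = P (z t \<theta>) * cos \<theta> + Q (z t \<theta>) * sin \<theta>" for t \<theta>
  define F' where "F' t \<theta> = F t \<theta> +
     t * (cos \<theta> * (Px (z t \<theta>) * cos \<theta> + Py (z t \<theta>) * sin \<theta>) +
          sin \<theta> * (Qx (z t \<theta>) * cos \<theta> + Qy (z t \<theta>) * sin \<theta>))" for t \<theta>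
  define N where "N t = integral (cbox 0 (2 * pi)) (\<lambda>\<theta>. t * F t \<theta>)" for t
  have M': "(M has_field_derivative integral (cbox 0 (2 * pi)) (F t)) (at t within {0..r})"
    if "t \<in> {0..r}" for t
    unfolding M_def
  proof (rule leibniz_rule_field_derivative)
    show "((\<lambda>t. w (z t \<theta>)) has_field_derivative F t \<theta>) (at t within {0..r})"
      if "t \<in> {0..r}" for t \<theta>
      unfolding F_def using that by (intro radial[of w P _ _ Q] dw zD)
    show "continuous_on ({0..r} \<times> cbox 0 (2 * pi)) (\<lambda>(t, \<theta>). F t \<theta>)"
      unfolding F_def split_beta
      by (intro continuous_intros zcont') auto
    show "(\<lambda>\<theta>. w (z t \<theta>)) integrable_on cbox 0 (2 * pi)" if "t \<in> {0..r}" for t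
      by (intro integrable_continuous zcont') (use that in \<open>auto intro!: continuous_intros\<close>)
  qed (use that in auto)
  have N': "(N has_field_derivative integral (cbox 0 (2 * pi)) (F' t)) (at t within {0..r})"
    if "t \<in> {0..r}" for t
    unfolding N_def
  proof (rule leibniz_rule_field_derivative)
    show "((\<lambda>t. t * F t \<theta>) has_field_derivative F' t \<theta>) (at t within {0..r})"
      if "t \<in> {0..r}" for t \<theta>
      unfolding F'_def F_def
      by (rule DERIV_cong[OF DERIV_mult[OF DERIV_ident
              DERIV_add[OF DERIV_cmult_right[OF radial_P] DERIV_cmult_right[OF radial_Q]]]])
        (use that zD in \<open>auto simp: algebra_simps\<close>)
    show "continuous_on ({0..r} \<times> cbox 0 (2 * pi)) (\<lambda>(t, \<theta>). F' t \<theta>)"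
      unfolding F'_def F_def split_beta
      by (intro continuous_intros zcont') auto
    show "(\<lambda>\<theta>. t * F t \<theta>) integrable_on cbox 0 (2 * pi)" if "t \<in> {0..r}" for t
      unfolding F_def
      by (intro integrable_continuous continuous_intros zcont') (use that in \<open>auto\<close>)
  qed (use that in auto)
  have N'_nonneg: "integral (cbox 0 (2 * pi)) (F' t) \<ge> 0" if t: "t \<in> {0..r}" for t
  proof -
    \<comment> \<open>the tangential component of the gradient and, below, its angular derivative\<close>
    define B where "B \<theta> = Q (z t \<theta>) * cos \<theta> - P (z t \<theta>) * sin \<theta>" for \<theta>
    define B' where "B' \<theta> = t * (Px (z t \<theta>) + Qy (z t \<theta>)) - F' t \<theta>" for \<theta>
    have "(B has_field_derivative B' \<theta>) (at \<theta> within {0..2 * pi})" for \<theta>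
    proof -
      have "(B has_field_derivative
        Q (z t \<theta>) * (- sin \<theta>) + t * (Qy (z t \<theta>) * cos \<theta> - Qx (z t \<theta>) * sin \<theta>) * cos \<theta> -
        (P (z t \<theta>) * cos \<theta> + t * (Py (z t \<theta>) * cos \<theta> - Px (z t \<theta>) * sin \<theta>) * sin \<theta>)) (at \<theta> within {0..2 * pi})"
        unfolding B_def
        by (intro DERIV_diff DERIV_mult' angular_P angular_Q zD t DERIV_cos DERIV_sin
            DERIV_cos[THEN DERIV_subset] DERIV_sin[THEN DERIV_subset] subset_UNIV)
      also have "Q (z t \<theta>) * (- sin \<theta>) + t * (Qy (z t \<theta>) * cos \<theta> - Qx (z t \<theta>) * sin \<theta>) * cos \<theta> -
        (P (z t \<theta>) * cos \<theta> + t * (Py (z t \<theta>) * cos \<theta> - Px (z t \<theta>) * sin \<theta>) * sin \<theta>) = B' \<theta>"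
        unfolding B'_def F'_def F_def using sin_cos_squared_add[of \<theta>] by algebra
      finally show ?thesis .
    qed
    then have "(B' has_integral B (2 * pi) - B 0) {0..2 * pi}"
      by (intro fundamental_theorem_of_calculus)
        (auto simp: has_real_derivative_iff_has_vector_derivative)
    moreover have "B (2 * pi) = B 0" by (simp add: B_def z_def cis.ctr)
    ultimately have B': "(B' has_integral 0) {0..2 * pi}" by simp
    have "(\<lambda>\<theta>. t * (Px (z t \<theta>) + Qy (z t \<theta>))) integrable_on {0..2 * pi}"
      by (intro integrable_continuous_real continuous_intros zcont') (use t in \<open>auto\<close>)
    then have L: "((\<lambda>\<theta>. t * (Px (z t \<theta>) + Qy (z t \<theta>))) has_integral
        integral {0..2 * pi} (\<lambda>\<theta>. t * (Px (z t \<theta>) + Qy (z t \<theta>)))) {0..2 * pi}"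
      by (rule integrable_integral)
    have "(F' t has_integral integral {0..2 * pi} (\<lambda>\<theta>. t * (Px (z t \<theta>) + Qy (z t \<theta>))) - 0) {0..2 * pi}"
      using has_integral_diff[OF L B'] by (simp add: B'_def)
    then have "integral {0..2 * pi} (F' t) = integral {0..2 * pi} (\<lambda>\<theta>. t * (Px (z t \<theta>) + Qy (z t \<theta>)))"
      by (simp add: integral_unique)
    also have "\<dots> \<ge> 0"
      using t laplace zD by (intro integral_nonneg[OF has_integral_integrable[OF L]]) auto
    finally show ?thesis by simp
  qed
  have N_nonneg: "N t \<ge> 0" if t: "t \<in> {0..r}" for t
  proof -
    have "N 0 \<le> N t"
    proof (rule DERIV_nonneg_imp_increasing_open[of 0 t N])
      show "continuous_on {0..t} N"
        using DERIV_continuous_on[OF N'] t by (auto intro: continuous_on_subset)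
      fix x assume x: "0 < x" "x < t"
      then have "(N has_field_derivative integral (cbox 0 (2 * pi)) (F' x)) (at x)"
        using N'[of x] t by (simp add: at_within_Icc_at)
      then show "\<exists>y. (N has_real_derivative y) (at x) \<and> 0 \<le> y"
        using N'_nonneg[of x] x t by auto
    qed (use t in auto)
    then show ?thesis by (simp add: N_def)
  qed
  have "M 0 \<le> M r"
  proof (rule DERIV_nonneg_imp_increasing_open[of 0 r M])
    show "continuous_on {0..r} M"
      using DERIV_continuous_on[OF M'] by auto
    fix x assume x: "0 < x" "x < r"
    then have "(M has_field_derivative integral (cbox 0 (2 * pi)) (F x)) (at x)"
      using M'[of x] by (simp add: at_within_Icc_at)
    moreover have "integral (cbox 0 (2 * pi)) (F x) \<ge> 0"
      using N_nonneg[of x] x by (simp add: N_def zero_le_mult_iff)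
    ultimately show "\<exists>y. (M has_real_derivative y) (at x) \<and> 0 \<le> y" by auto
  qed (use r in auto)
  then show ?thesis by (simp add: M_def z_def)
qed

lemma subharmonic_on_laplace_nonneg:
  fixes w P Q Px Py Qx Qy :: "complex \<Rightarrow> real"
  assumes dw: "\<And>\<zeta>. \<zeta> \<in> D \<Longrightarrow> (w has_derivative (\<lambda>h. P \<zeta> * Re h + Q \<zeta> * Im h)) (at \<zeta>)"
    and dP: "\<And>\<zeta>. \<zeta> \<in> D \<Longrightarrow> (P has_derivative (\<lambda>h. Px \<zeta> * Re h + Py \<zeta> * Im h)) (at \<zeta>)"
    and dQ: "\<And>\<zeta>. \<zeta> \<in> D \<Longrightarrow> (Q has_derivative (\<lambda>h. Qx \<zeta> * Re h + Qy \<zeta> * Im h)) (at \<zeta>)"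
    and cont: "continuous_on D Px" "continuous_on D Py" "continuous_on D Qx" "continuous_on D Qy"
    and laplace: "\<And>\<zeta>. \<zeta> \<in> D \<Longrightarrow> Px \<zeta> + Qy \<zeta> \<ge> 0"
  shows "subharmonic_on D (\<lambda>\<zeta>. ereal (w \<zeta>))"
proof (rule subharmonic_onI)
  have cw: "continuous_on D w"
    using dw by (meson has_derivative_continuous continuous_at_imp_continuous_on)
  then show usc: "usc_on D (\<lambda>\<zeta>. ereal (w \<zeta>))" by (rule usc_on_continuous)
  fix a r assume r: "r > (0::real)" "cball a r \<subseteq> D"
  obtain C where C: "C \<ge> 0" "\<And>z. z \<in> cball a r \<Longrightarrow> ereal (w z) \<le> ereal C"
    using usc_on_bounded_above[OF usc _ compact_cball r(2)] by auto
  define g where "g \<theta> = C - w (a + of_real r * cis \<theta>)" for \<theta>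
  have g_nonneg: "g \<theta> \<ge> 0" for \<theta>
    using C(2)[OF circle_in_cball, of \<theta>] r(1) by (simp add: g_def)
  have cg: "continuous_on S (\<lambda>\<theta>. w (a + of_real r * cis \<theta>))" for S
    by (rule continuous_on_compose2[OF cw])
      (use r circle_in_cball[of r a] in \<open>auto intro!: continuous_intros\<close>)
  have g_int: "(g has_integral (2 * pi * C - integral {0..2 * pi} (\<lambda>\<theta>. w (a + of_real r * cis \<theta>)))) {0..2 * pi}"
    unfolding g_def
    using has_integral_diff[OF has_integral_const_real[of C 0 "2 * pi"]
        integrable_integral[OF integrable_continuous_real[OF cg]]] by simp
  have "(\<integral>\<^sup>+\<theta>\<in>{0..2 * pi}. e2ennreal (ereal C - ereal (w (a + of_real r * cis \<theta>))) \<partial>lborel) =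
      (\<integral>\<^sup>+\<theta>\<in>{0..2 * pi}. ennreal (g \<theta>) \<partial>lborel)"
    by (intro nn_integral_cong) (simp add: g_def)
  also have "\<dots> = ennreal (2 * pi * C - integral {0..2 * pi} (\<lambda>\<theta>. w (a + of_real r * cis \<theta>)))"
    using g_nonneg g_int by (intro nn_integral_has_integral_lebesgue') auto
  also have "\<dots> \<le> ennreal (2 * pi * (C - w a))"
    using circle_integral_submean[OF r dw dP dQ cont laplace]
    by (intro ennreal_leI) (simp add: algebra_simps)
  also have "\<dots> = ennreal (2 * pi) * e2ennreal (ereal C - ereal (w a))"
    using C(2)[of a] r(1) by (simp add: ennreal_mult)
  finally show "\<exists>C\<ge>0. (\<forall>z\<in>cball a r. ereal (w z) \<le> ereal C) \<and>
        (\<integral>\<^sup>+\<theta>\<in>{0..2 * pi}. e2ennreal (ereal C - ereal (w (a + of_real r * cis \<theta>))) \<partial>lborel)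
          \<le> ennreal (2 * pi) * e2ennreal (ereal C - ereal (w a))"
    using C by blast
qed auto

section \<open>Calculus of \<open>C^k\<close> functions\<close>

lemma frechet_derivative_cong_open:
  assumes "open S" "x \<in> S" "\<And>y. y \<in> S \<Longrightarrow> f y = g y"
  shows "frechet_derivative f (at x) = frechet_derivative g (at x)"
proof -
  have "(f has_derivative d) (at x) \<longleftrightarrow> (g has_derivative d) (at x)" for d
    using assms has_derivative_transform_within_open[of f d x UNIV S g]
      has_derivative_transform_within_open[of g d x UNIV S f] by auto
  then show ?thesis by (simp add: frechet_derivative_def)
qed

lemma Ck_on_cong:
  assumes S: "open S"
  shows "(\<And>x. x \<in> S \<Longrightarrow> f x = g x) \<Longrightarrow> Ck_on k S f \<Longrightarrow> Ck_on k S g"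
proof (induction k arbitrary: f g)
  case 0
  then show ?case using continuous_on_cong[of S S f g] by simp
next
  case (Suc k)
  have "g differentiable at x" if "x \<in> S" for x
  proof -
    have "(f has_derivative frechet_derivative f (at x)) (at x)"
      using Suc.prems(2) that by (simp add: frechet_derivative_works)
    then show ?thesis
      using has_derivative_transform_within_open[of f _ x UNIV S g, OF _ S that Suc.prems(1)]
      unfolding differentiable_def by blast
  qed
  moreover have "Ck_on k S (\<lambda>x. frechet_derivative g (at x) v)" for v
  proof (rule Suc.IH)
    show "frechet_derivative f (at x) v = frechet_derivative g (at x) v" if "x \<in> S" for x
      using frechet_derivative_cong_open[OF S that Suc.prems(1)] by simp
    show "Ck_on k S (\<lambda>x. frechet_derivative f (at x) v)" using Suc.prems(2) by simp
  qed
  ultimately show ?case by simp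
qed

lemma Ck_on_SucD: "Ck_on (Suc k) S f \<Longrightarrow> Ck_on k S f"
proof (induction k arbitrary: f)
  case 0
  then show ?case
    by (auto intro!: continuous_at_imp_continuous_on differentiable_imp_continuous_within)
next
  case (Suc k)
  then have "\<forall>x\<in>S. f differentiable at x" "\<And>v. Ck_on (Suc k) S (\<lambda>x. frechet_derivative f (at x) v)"
    unfolding Ck_on.simps(2)[of "Suc k"] by blast+
  then show ?case using Suc.IH by (simp only: Ck_on.simps(2)[of k]) simp
qed

text \<open>The derivative of a combination is a combination of the functions and their derivatives, so
  each closure property follows by induction from this rule.\<close>

lemma Ck_on_SucI:
  assumes "open S" "\<And>x. x \<in> S \<Longrightarrow> (f has_derivative f' x) (at x)"
    and "\<And>v. Ck_on k S (\<lambda>x. f' x v)"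
  shows "Ck_on (Suc k) S f"
proof -
  have "f' x v = frechet_derivative f (at x) v" if "x \<in> S" for x v
    using frechet_derivative_at[OF assms(2)[OF that]] by simp
  then have "Ck_on k S (\<lambda>x. frechet_derivative f (at x) v)" for v
    by (rule Ck_on_cong[OF assms(1) _ assms(3)])
  then show ?thesis using assms(2) by (auto simp: differentiable_def)
qed

lemma Ck_on_Suc_has_derivative:
  "Ck_on (Suc k) S f \<Longrightarrow> x \<in> S \<Longrightarrow> (f has_derivative frechet_derivative f (at x)) (at x)"
  by (simp add: frechet_derivative_works)

lemma Ck_on_const: "open S \<Longrightarrow> Ck_on k S (\<lambda>x. c)"
proof (induction k arbitrary: c)
  case (Suc k)
  then show ?case by (intro Ck_on_SucI[where f' = "\<lambda>x v. 0"]) auto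
qed simp

lemma Ck_on_bounded_linear:
  assumes "open S" "bounded_linear f"
  shows "Ck_on k S f"
proof (cases k)
  case 0
  then show ?thesis using assms by (simp add: linear_continuous_on)
next
  case (Suc k')
  then show ?thesis
    using assms by (auto intro!: Ck_on_SucI[where f' = "\<lambda>x. f"] Ck_on_const bounded_linear_imp_has_derivative simp del: Ck_on.simps)
qed

lemma Ck_on_add:
  assumes S: "open S"
  shows "Ck_on k S f \<Longrightarrow> Ck_on k S g \<Longrightarrow> Ck_on k S (\<lambda>x. f x + g x)"
proof (induction k arbitrary: f g)
  case 0
  then show ?case by (simp add: continuous_on_add)
next
  case (Suc k)
  show ?case
    by (rule Ck_on_SucI[OF S has_derivative_add[OF Ck_on_Suc_has_derivative Ck_on_Suc_has_derivative]])
      (use Suc in \<open>auto simp del: Ck_on.simps(2)\<close>, simp)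
qed

lemma Ck_on_mult:
  assumes S: "open S"
  shows "Ck_on k S f \<Longrightarrow> Ck_on k S g \<Longrightarrow> Ck_on k S (\<lambda>x. f x * g x)"
proof (induction k arbitrary: f g)
  case 0
  then show ?case by (simp add: continuous_on_mult)
next
  case (Suc k)
  have "Ck_on k S (\<lambda>x. f x * frechet_derivative g (at x) v + frechet_derivative f (at x) v * g x)" for v
    using Suc.prems Suc.prems[THEN Ck_on_SucD] by (intro Ck_on_add[OF S] Suc.IH) auto
  then show ?case
    by (intro Ck_on_SucI[OF S has_derivative_mult[OF Ck_on_Suc_has_derivative[OF Suc.prems(1)]
            Ck_on_Suc_has_derivative[OF Suc.prems(2)]]])
qed

lemma Ck_on_diff:
  assumes S: "open S" and "Ck_on k S f" "Ck_on k S g"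
  shows "Ck_on k S (\<lambda>x. f x - g x)"
  using Ck_on_add[OF S assms(2) Ck_on_mult[OF S Ck_on_const[OF S, of k "-1"] assms(3)]] by simp

lemma Ck_on_sum:
  assumes S: "open S" and "\<And>i. i \<in> I \<Longrightarrow> Ck_on k S (f i)"
  shows "Ck_on k S (\<lambda>x. \<Sum>i\<in>I. f i x)"
  using assms(2)
  by (induction I rule: infinite_finite_induct) (auto intro!: Ck_on_const Ck_on_add S)

lemma Ck_on_inverse:
  assumes S: "open S" and nz: "\<And>x. x \<in> S \<Longrightarrow> f x \<noteq> 0"
  shows "Ck_on k S f \<Longrightarrow> Ck_on k S (\<lambda>x. inverse (f x))"
proof (induction k)
  case 0
  then show ?case using nz by (simp add: continuous_on_inverse)
next
  case (Suc k)
  have inv: "Ck_on k S (\<lambda>x. inverse (f x))" by (rule Suc.IH[OF Ck_on_SucD[OF Suc.prems]])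
  have "Ck_on k S (\<lambda>x. - 1 * (inverse (f x) * frechet_derivative f (at x) v * inverse (f x)))" for v
    using Suc.prems by (intro Ck_on_mult[OF S] Ck_on_const[OF S] inv) auto
  then show ?case
    using nz by (intro Ck_on_SucI[OF S Deriv.has_derivative_inverse[OF _ Ck_on_Suc_has_derivative[OF Suc.prems]]]) auto
qed

lemma Ck_on_ln:
  assumes S: "open S" and pos: "\<And>x. x \<in> S \<Longrightarrow> f x > 0" and f: "Ck_on k S f"
  shows "Ck_on k S (\<lambda>x. ln (f x))"
proof (cases k)
  case 0
  then show ?thesis using f pos by (auto intro!: continuous_on_ln simp: less_imp_neq[symmetric])
next
  case (Suc k')
  have "Ck_on k' S (\<lambda>x. frechet_derivative f (at x) v * inverse (f x))" for v
    using f f[unfolded Suc, THEN Ck_on_SucD] pos Suc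
    by (intro Ck_on_mult[OF S] Ck_on_inverse[OF S]) (auto simp: less_imp_neq[symmetric])
  then show ?thesis
    unfolding Suc
    using pos by (intro Ck_on_SucI[OF S has_derivative_ln[OF _ Ck_on_Suc_has_derivative[OF f[unfolded Suc]]]])
      auto
qed

section \<open>The operator \<open>dd\<^sup>c\<close> in terms of second directional derivatives\<close>

definition second_deriv :: "('a::real_normed_vector \<Rightarrow> real) \<Rightarrow> 'a \<Rightarrow> 'a \<Rightarrow> 'a \<Rightarrow> real" where
  "second_deriv u z v w = frechet_derivative (\<lambda>x. frechet_derivative u (at x) w) (at z) v"

lemma C2_on_first_has_derivative:
  assumes "Ck_on 2 S u" "x \<in> S"
  shows "(u has_derivative frechet_derivative u (at x)) (at x)"
  using assms by (intro Ck_on_Suc_has_derivative[of "Suc 0" S]) (simp_all add: numeral_2_eq_2)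

lemma C2_on_second_has_derivative:
  assumes "Ck_on 2 S u" "x \<in> S"
  shows "((\<lambda>x. frechet_derivative u (at x) w) has_derivative (\<lambda>v. second_deriv u x v w)) (at x)"
  unfolding second_deriv_def
  using assms by (intro Ck_on_Suc_has_derivative[of 0 S]) (simp_all add: numeral_2_eq_2)

lemma C2_on_second_continuous:
  assumes "Ck_on 2 S u"
  shows "continuous_on S (\<lambda>x. second_deriv u x v w)"
  using assms by (simp add: numeral_2_eq_2 second_deriv_def)

lemma second_deriv_eqI:
  assumes "open S" "z \<in> S" "\<And>x. x \<in> S \<Longrightarrow> (u has_derivative u' x) (at x)"
    and "((\<lambda>x. u' x w) has_derivative d) (at z)"
  shows "second_deriv u z v w = d v"
proof -
  have "frechet_derivative u (at x) w = u' x w" if "x \<in> S" for x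
    using frechet_derivative_at[OF assms(3)[OF that]] by simp
  then have "frechet_derivative (\<lambda>x. frechet_derivative u (at x) w) (at z)
      = frechet_derivative (\<lambda>x. u' x w) (at z)"
    by (intro frechet_derivative_cong_open[OF assms(1,2)])
  then show ?thesis
    using frechet_derivative_at[OF assms(4)] by (simp add: second_deriv_def)
qed

lemma second_deriv_diff:
  assumes S: "open S" "z \<in> S" and u: "Ck_on 2 S u" and v: "Ck_on 2 S v"
  shows "second_deriv (\<lambda>x. u x - v x) z a b = second_deriv u z a b - second_deriv v z a b"
  by (rule second_deriv_eqI[OF S has_derivative_diff has_derivative_diff])
    (use u v S in \<open>auto intro: C2_on_first_has_derivative C2_on_second_has_derivative\<close>)

lemma second_deriv_uminus_right:
  assumes S: "open S" "z \<in> S" and u: "Ck_on 2 S u"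
  shows "second_deriv u z a (- b) = - second_deriv u z a b"
proof (rule second_deriv_eqI[OF S C2_on_first_has_derivative[OF u]])
  have "frechet_derivative u (at x) (- b) = - frechet_derivative u (at x) b" if "x \<in> S" for x
    using linear_neg[OF has_derivative_linear[OF C2_on_first_has_derivative[OF u that]]] .
  then show "((\<lambda>x. frechet_derivative u (at x) (- b)) has_derivative (\<lambda>a. - second_deriv u z a b)) (at z)"
    by (intro has_derivative_transform_within_open[OF
        has_derivative_minus[OF C2_on_second_has_derivative[OF u S(2), of b]] S]) simp
qed

text \<open>
  The conjugate-linear part of the differential minus the linear part is \<open>\<i>\<close> times the derivative in
  direction \<open>\<i> w\<close>, so \<open>dc u x w\<close> is that derivative times \<open>- 1 / (2 \<pi>)\<close>.
\<close>

lemma ddc_eq_second_deriv: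
  assumes S: "open S" "z \<in> S" and u: "Ck_on 2 S u"
  shows "ddc u z v w =
    complex_of_real ((second_deriv u z w (\<i> *s v) - second_deriv u z v (\<i> *s w)) / (2 * pi))"
proof -
  have dc: "dc u x a = complex_of_real (- (frechet_derivative u (at x) (\<i> *s a)) / (2 * pi))" for x a
    by (simp add: dc_def del_def delbar_def field_simps)
  have "frechet_derivative (\<lambda>x. dc u x a) (at z) b =
      complex_of_real (- (second_deriv u z b (\<i> *s a)) / (2 * pi))" for a b
  proof -
    have "((\<lambda>x. dc u x a) has_derivative
        (\<lambda>b. complex_of_real (- (second_deriv u z b (\<i> *s a)) / (2 * pi)))) (at z)"
      unfolding dc
      by (intro has_derivative_of_real has_derivative_divide has_derivative_minus
          bounded_linear.has_derivative[OF bounded_linear_divide]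
          C2_on_second_has_derivative[OF u S(2)])
    from frechet_derivative_at[OF this] show ?thesis by metis
  qed
  then show ?thesis
    by (simp add: ddc_def ext_deriv_def field_simps)
qed

lemma ddc_diff:
  assumes "open S" "z \<in> S" "Ck_on 2 S u" "Ck_on 2 S v"
  shows "ddc (\<lambda>x. u x - v x) z a b = ddc u z a b - ddc v z a b"
  using assms Ck_on_diff[of S 2 u v]
  by (simp add: ddc_eq_second_deriv[of S] second_deriv_diff[of S] diff_divide_distrib)

lemma ddc_cong_open:
  assumes "open S" "z \<in> S" "Ck_on 2 S u" "\<And>x. x \<in> S \<Longrightarrow> u x = v x"
  shows "ddc u z = ddc v z"
proof -
  have "dc u x = dc v x" if "x \<in> S" for x
    using frechet_derivative_cong_open[OF assms(1) that assms(4)]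
    by (simp add: fun_eq_iff dc_def del_def delbar_def)
  then have "frechet_derivative (\<lambda>x. dc u x a) (at z) = frechet_derivative (\<lambda>x. dc v x a) (at z)" for a
    by (intro frechet_derivative_cong_open[OF assms(1,2)]) simp
  then show ?thesis by (simp add: fun_eq_iff ddc_def ext_deriv_def)
qed

text \<open>
  On the complex line spanned by \<open>b\<close>, the form \<open>dd\<^sup>c u\<close> is the Laplacian of the restriction of \<open>u\<close>, up
  to the factor \<open>2 \<pi>\<close>. This links positivity of the form with subharmonicity on lines.
\<close>

lemma ddc_complex_line:
  assumes S: "open S" "z \<in> S" and u: "Ck_on 2 S u"
  shows "ddc u z b (\<i> *s b) =
    complex_of_real ((second_deriv u z b b + second_deriv u z (\<i> *s b) (\<i> *s b)) / (2 * pi))"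
proof -
  have "\<i> *s (\<i> *s b) = - b" by (simp add: vec_eq_iff)
  then show ?thesis
    using second_deriv_uminus_right[OF S u, of b b] by (simp add: ddc_eq_second_deriv[OF S u])
qed

text \<open>
  Frechet derivatives are only real linear, so complex multiples of a direction have to be split
  into real multiples of \<open>b\<close> and \<open>\<i> b\<close>.
\<close>

lemma scaled_vector_Re_Im: "h *s b = Re h *\<^sub>R b + Im h *\<^sub>R (\<i> *s b)"
  for b :: "complex ^ 'n"
  by (simp add: vec_eq_iff complex_eq_iff)

lemma has_derivative_along_complex_line:
  fixes f :: "complex ^ 'n::finite \<Rightarrow> real"
  assumes "(f has_derivative f') (at (a + \<zeta> *s b))"
  shows "((\<lambda>\<zeta>. f (a + \<zeta> *s b)) has_derivative (\<lambda>h. f' b * Re h + f' (\<i> *s b) * Im h)) (at \<zeta>)"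
proof -
  have "bounded_linear (\<lambda>\<zeta>. \<zeta> *s b)"
    by (subst scaled_vector_Re_Im[abs_def])
      (intro bounded_linear_add bounded_linear_scaleR_const bounded_linear_Re bounded_linear_Im)
  then have "((\<lambda>\<zeta>. a + \<zeta> *s b) has_derivative (\<lambda>h. h *s b)) (at \<zeta>)"
    by (auto intro!: derivative_eq_intros bounded_linear_imp_has_derivative)
  from has_derivative_compose[OF this assms]
  have deriv: "((\<lambda>\<zeta>. f (a + \<zeta> *s b)) has_derivative (\<lambda>h. f' (h *s b))) (at \<zeta>)" .
  have "f' (h *s b) = f' b * Re h + f' (\<i> *s b) * Im h" for h
    unfolding scaled_vector_Re_Im[of h b]
    using has_derivative_linear[OF assms] by (simp add: linear_add linear_cmul)
  then show ?thesis by (intro has_derivative_eq_rhs[OF deriv] ext)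
qed

lemma psh_on_ddc_nonneg:
  fixes u :: "complex ^ 'n::finite \<Rightarrow> real"
  assumes S: "open S" and u: "Ck_on 2 S u"
    and nonneg: "\<And>z b. z \<in> S \<Longrightarrow> Re (ddc u z b (\<i> *s b)) \<ge> 0"
  shows "psh_on S (\<lambda>z. ereal (u z))"
  unfolding psh_on_def
proof (intro conjI ballI allI)
  have "continuous_on S u"
    using Ck_on_SucD[OF Ck_on_SucD[OF u[unfolded numeral_2_eq_2]]] by simp
  then show "usc_on S (\<lambda>z. ereal (u z))" by (rule usc_on_continuous)
  fix a b
  let ?D = "{\<zeta>. a + \<zeta> *s b \<in> S}"
  have cont: "continuous_on ?D (\<lambda>\<zeta>. second_deriv u (a + \<zeta> *s b) v w)" for v w
    by (rule continuous_on_compose2[OF C2_on_second_continuous[OF u]])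
      (auto simp: vector_scalar_mult_def intro!: continuous_intros)
  show "subharmonic_on ?D (\<lambda>\<zeta>. ereal (u (a + \<zeta> *s b)))"
  proof (rule subharmonic_on_laplace_nonneg)
    fix \<zeta> assume "\<zeta> \<in> ?D"
    then have z: "a + \<zeta> *s b \<in> S" by simp
    show "((\<lambda>\<zeta>. u (a + \<zeta> *s b)) has_derivative (\<lambda>h. frechet_derivative u (at (a + \<zeta> *s b)) b * Re h +
        frechet_derivative u (at (a + \<zeta> *s b)) (\<i> *s b) * Im h)) (at \<zeta>)"
      by (rule has_derivative_along_complex_line[OF C2_on_first_has_derivative[OF u z]])
    show "((\<lambda>\<zeta>. frechet_derivative u (at (a + \<zeta> *s b)) b) has_derivative
        (\<lambda>h. second_deriv u (a + \<zeta> *s b) b b * Re h + second_deriv u (a + \<zeta> *s b) (\<i> *s b) b * Im h)) (at \<zeta>)"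
      by (rule has_derivative_along_complex_line[OF C2_on_second_has_derivative[OF u z]])
    show "((\<lambda>\<zeta>. frechet_derivative u (at (a + \<zeta> *s b)) (\<i> *s b)) has_derivative
        (\<lambda>h. second_deriv u (a + \<zeta> *s b) b (\<i> *s b) * Re h +
          second_deriv u (a + \<zeta> *s b) (\<i> *s b) (\<i> *s b) * Im h)) (at \<zeta>)"
      by (rule has_derivative_along_complex_line[OF C2_on_second_has_derivative[OF u z]])
    show "second_deriv u (a + \<zeta> *s b) b b + second_deriv u (a + \<zeta> *s b) (\<i> *s b) (\<i> *s b) \<ge> 0"
      using nonneg[OF z, of b] by (simp add: ddc_complex_line[OF S z u] zero_le_divide_iff not_le[THEN iffD2, OF pi_gt_zero])
  qed (fact cont)+
qed auto

section \<open>The Fubini--Study form\<close>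

definition affine_lift_linear :: "'n option \<Rightarrow> complex ^ 'n \<Rightarrow> complex ^ ('n::finite option)" where
  "affine_lift_linear j z =
     (\<chi> i. if i = j then 0 else (case i of None \<Rightarrow> z $ the j | Some k \<Rightarrow> z $ k))"

lemma affine_lift_eq: "affine_lift j z = axis j 1 + affine_lift_linear j z"
  by (simp add: vec_eq_iff affine_lift_def affine_lift_linear_def axis_def)

lemma affine_lift_nth_base [simp]: "affine_lift j z $ j = 1"
  by (simp add: affine_lift_def)

lemma affine_lift_nonzero [simp]: "affine_lift j z \<noteq> 0"
  using affine_lift_nth_base[of j z] by (metis zero_index zero_neq_one)

lemma affine_lift_linear_scale: "affine_lift_linear j (c *s z) = c *s affine_lift_linear j z"
  by (simp add: vec_eq_iff affine_lift_linear_def split: option.split)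

lemma bounded_linear_affine_lift_linear: "bounded_linear (affine_lift_linear j)"
  by (rule linear_conv_bounded_linear[THEN iffD1], rule linearI)
    (simp_all add: vec_eq_iff affine_lift_linear_def split: option.split)

lemma has_derivative_affine_lift:
  "(affine_lift j has_derivative affine_lift_linear j) (at z within S)"
proof -
  have "((\<lambda>z. axis j 1 + affine_lift_linear j z) has_derivative (\<lambda>h. 0 + affine_lift_linear j h)) (at z within S)"
    by (intro has_derivative_add has_derivative_const bounded_linear_imp_has_derivative
        bounded_linear_affine_lift_linear)
  then show ?thesis by (simp add: affine_lift_eq[abs_def])
qed

lemma continuous_on_affine_lift: "continuous_on S (affine_lift j)"
  using has_derivative_affine_lift by (meson has_derivative_continuous_on)

lemma has_derivative_affine_lift_nth:
  "((\<lambda>z. affine_lift k z $ j) has_derivative (\<lambda>v. affine_lift_linear k v $ j)) (at z within S)"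
  by (rule bounded_linear.has_derivative[OF bounded_linear_vec_nth has_derivative_affine_lift])

lemma Ck_on_norm_square_affine_lift_nth:
  assumes "open S"
  shows "Ck_on m S (\<lambda>z. (norm (affine_lift k z $ j))\<^sup>2)"
proof -
  have lin: "bounded_linear (\<lambda>z. Re (affine_lift_linear k z $ j))"
    "bounded_linear (\<lambda>z. Im (affine_lift_linear k z $ j))"
    by (intro bounded_linear_compose[OF bounded_linear_Re] bounded_linear_compose[OF bounded_linear_Im]
        bounded_linear_compose[OF bounded_linear_vec_nth] bounded_linear_affine_lift_linear)+
  have Re: "Ck_on m S (\<lambda>z. Re (axis k 1 $ j) + Re (affine_lift_linear k z $ j))"
    and Im: "Ck_on m S (\<lambda>z. Im (axis k 1 $ j) + Im (affine_lift_linear k z $ j))"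
    by (intro Ck_on_add Ck_on_const Ck_on_bounded_linear assms lin)+
  show ?thesis
    using Ck_on_add[OF assms Ck_on_mult[OF assms Re Re] Ck_on_mult[OF assms Im Im]]
    by (simp only: affine_lift_eq vector_add_component cmod_power2 plus_complex.sel)
      (simp only: power2_eq_square)
qed

lemma ln_norm_eq: "x \<noteq> 0 \<Longrightarrow> ln (norm x) = 1 / 2 * ln ((norm x)\<^sup>2)"
  for x :: "'a::real_normed_vector"
  by (simp add: ln_realpow)

lemma Ck_on_ln_norm_affine_lift:
  assumes "open S"
  shows "Ck_on m S (\<lambda>z. ln (norm (affine_lift k z)))"
proof -
  have sq: "(norm (affine_lift k z))\<^sup>2 = (\<Sum>i\<in>UNIV. (norm (affine_lift k z $ i))\<^sup>2)" for z
    by (simp add: norm_vec_def L2_set_def sum_nonneg)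
  have "Ck_on m S (\<lambda>z. 1 / 2 * ln ((norm (affine_lift k z))\<^sup>2))"
  proof (intro Ck_on_mult Ck_on_const Ck_on_ln assms)
    show "Ck_on m S (\<lambda>z. (norm (affine_lift k z))\<^sup>2)"
      unfolding sq by (intro Ck_on_sum Ck_on_norm_square_affine_lift_nth assms)
  qed simp
  then show ?thesis
    by (rule Ck_on_cong[OF assms, rotated]) (simp add: ln_norm_eq)
qed

lemma Ck_on_ln_norm_affine_lift_nth:
  assumes "open S" "\<And>z. z \<in> S \<Longrightarrow> affine_lift k z $ j \<noteq> 0"
  shows "Ck_on m S (\<lambda>z. ln (norm (affine_lift k z $ j)))"
proof -
  have "Ck_on m S (\<lambda>z. 1 / 2 * ln ((norm (affine_lift k z $ j))\<^sup>2))"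
    using assms by (intro Ck_on_mult Ck_on_const Ck_on_ln Ck_on_norm_square_affine_lift_nth) auto
  then show ?thesis
    by (rule Ck_on_cong[OF assms(1), rotated]) (use assms(2) in \<open>simp add: ln_norm_eq\<close>)
qed

text \<open>
  Cauchy--Schwarz for \<open>A\<close> and \<open>X = (A \<bullet> B) B + (A \<bullet> C) C\<close>: if \<open>s\<close> is the left-hand side, then \<open>A \<bullet> X = s\<close>
  and \<open>X \<bullet> X = s (B \<bullet> B)\<close>. For \<open>C = \<i> B\<close> the left-hand side is the squared modulus of the Hermitian
  product, so this is the complex Cauchy--Schwarz inequality in real terms.
\<close>

lemma Bessel_inequality_two:
  fixes A B C :: "'a::real_inner"
  assumes orth: "B \<bullet> C = 0" and norms: "C \<bullet> C = B \<bullet> B"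
  shows "(A \<bullet> B)\<^sup>2 + (A \<bullet> C)\<^sup>2 \<le> (A \<bullet> A) * (B \<bullet> B)"
proof -
  define s where "s = (A \<bullet> B)\<^sup>2 + (A \<bullet> C)\<^sup>2"
  define X where "X = (A \<bullet> B) *\<^sub>R B + (A \<bullet> C) *\<^sub>R C"
  have AX: "A \<bullet> X = s"
    by (simp add: X_def s_def inner_add_right power2_eq_square)
  have XX: "X \<bullet> X = s * (B \<bullet> B)"
    using orth norms
    by (simp add: X_def s_def inner_add_right inner_add_left inner_commute[of C B] power2_eq_square algebra_simps)
  have "s * s \<le> s * ((A \<bullet> A) * (B \<bullet> B))"
    using Cauchy_Schwarz_ineq[of A X] by (simp add: AX XX power2_eq_square mult_ac)
  moreover have "s \<ge> 0" by (simp add: s_def)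
  ultimately have "s \<le> (A \<bullet> A) * (B \<bullet> B)"
    by (cases "s = 0") (auto simp: mult_le_cancel_left)
  then show ?thesis by (simp add: s_def)
qed

lemma inner_ii_scaled:
  fixes B :: "complex ^ 'n::finite"
  shows "B \<bullet> (\<i> *s B) = 0" "(\<i> *s B) \<bullet> (\<i> *s B) = B \<bullet> B"
  by (simp_all add: inner_vec_def inner_complex_def algebra_simps)

lemma has_derivative_ln_norm_affine_lift:
  "((\<lambda>z. ln (norm (affine_lift k z))) has_derivative
    (\<lambda>w. (affine_lift k z \<bullet> affine_lift_linear k w) / (affine_lift k z \<bullet> affine_lift k z))) (at z)"
proof -
  have "((\<lambda>z. 1 / 2 * ln (affine_lift k z \<bullet> affine_lift k z)) has_derivative
    (\<lambda>w. (affine_lift k z \<bullet> affine_lift_linear k w) / (affine_lift k z \<bullet> affine_lift k z))) (at z)"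
    by (auto intro!: derivative_eq_intros has_derivative_affine_lift
        simp: fun_eq_iff inner_commute[of "affine_lift_linear _ _"] field_simps)
  then show ?thesis by (simp add: ln_norm_eq power2_norm_eq_inner)
qed

lemma second_deriv_ln_norm_affine_lift:
  "second_deriv (\<lambda>z. ln (norm (affine_lift k z))) z w w =
    ((affine_lift_linear k w \<bullet> affine_lift_linear k w) * (affine_lift k z \<bullet> affine_lift k z)
      - 2 * (affine_lift k z \<bullet> affine_lift_linear k w)\<^sup>2) / (affine_lift k z \<bullet> affine_lift k z)\<^sup>2"
proof -
  let ?A = "affine_lift k" and ?L = "affine_lift_linear k"
  have "((\<lambda>x. (?A x \<bullet> ?L w) / (?A x \<bullet> ?A x)) has_derivative
      (\<lambda>v. ((?L v \<bullet> ?L w) * (?A z \<bullet> ?A z) - 2 * (?A z \<bullet> ?L w) * (?A z \<bullet> ?L v)) / (?A z \<bullet> ?A z)\<^sup>2)) (at z)"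
    by (auto intro!: derivative_eq_intros has_derivative_affine_lift
        simp: fun_eq_iff inner_commute[of "affine_lift_linear _ _" "affine_lift _ _"] power2_eq_square field_simps)
  from second_deriv_eqI[OF open_UNIV UNIV_I has_derivative_ln_norm_affine_lift this]
  show ?thesis by (simp add: power2_eq_square mult_ac)
qed

text \<open>
  Along a complex line in direction \<open>b\<close>, with \<open>A\<close> the lifted point and \<open>B\<close> the lifted direction, the
  Laplacian of \<open>ln (norm (affine_lift k z))\<close> is
  \<open>2 (|A|\<^sup>2 |B|\<^sup>2 - |\<langle>A, B\<rangle>|\<^sup>2) / |A|\<^sup>4\<close>.
\<close>

lemma fubini_study_nonneg: "Re (fubini_study k z b (\<i> *s b)) \<ge> 0"
proof -
  let ?A = "affine_lift k z" and ?B = "affine_lift_linear k b"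
  have "(?A \<bullet> ?B)\<^sup>2 + (?A \<bullet> (\<i> *s ?B))\<^sup>2 \<le> (?A \<bullet> ?A) * (?B \<bullet> ?B)"
    by (intro Bessel_inequality_two inner_ii_scaled)
  then have "0 \<le> (2 * ((?A \<bullet> ?A) * (?B \<bullet> ?B) - ((?A \<bullet> ?B)\<^sup>2 + (?A \<bullet> (\<i> *s ?B))\<^sup>2))) / (?A \<bullet> ?A)\<^sup>2"
    by simp
  also have "\<dots> = second_deriv (\<lambda>z. ln (norm (affine_lift k z))) z b b +
      second_deriv (\<lambda>z. ln (norm (affine_lift k z))) z (\<i> *s b) (\<i> *s b)"
    unfolding second_deriv_ln_norm_affine_lift affine_lift_linear_scale inner_ii_scaled(2)
    by (simp add: add_divide_distrib[symmetric] algebra_simps)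
  finally show ?thesis
    using ddc_complex_line[OF open_UNIV UNIV_I Ck_on_ln_norm_affine_lift[OF open_UNIV], of k z b]
    by (simp add: fubini_study_def)
qed

text \<open>
  The logarithm of the modulus of a nonvanishing affine function \<open>l\<close> is pluriharmonic: its derivative
  in direction \<open>w\<close> is the real part of \<open>L w / l\<close>, with \<open>L\<close> the linear part of \<open>l\<close>, and the second
  derivatives in the directions \<open>v\<close>, \<open>\<i> w\<close> and \<open>w\<close>, \<open>\<i> v\<close> coincide.
\<close>

lemma ddc_ln_norm_affine_lift_nth:
  assumes nz: "affine_lift k z $ j \<noteq> 0"
  shows "ddc (\<lambda>z. ln (norm (affine_lift k z $ j))) z v w = 0"
proof -
  let ?l = "\<lambda>z. affine_lift k z $ j" and ?L = "\<lambda>v. affine_lift_linear k v $ j"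
  define S where "S = {z. ?l z \<noteq> 0}"
  have S: "open S"
    unfolding S_def
    by (intro open_Collect_neq continuous_intros continuous_on_affine_lift)
  have z: "z \<in> S" using nz by (simp add: S_def)
  have Re_div: "Re (a / b) = (b \<bullet> a) / (norm b)\<^sup>2" for a b :: complex
    by (simp add: Re_divide cmod_power2 inner_complex_def mult.commute)
  have first: "((\<lambda>z. ln (norm (?l z))) has_derivative (\<lambda>w. Re (?L w / ?l x))) (at x)" if "x \<in> S" for x
  proof -
    have "((\<lambda>z. ln (norm (?l z))) has_derivative (\<lambda>w. inverse (norm (?l x)) * (?L w \<bullet> sgn (?l x)))) (at x)"
      using that has_derivative_compose[OF has_derivative_affine_lift_nth has_derivative_norm, of k x j]
      by (auto intro!: derivative_eq_intros has_derivative_affine_lift_nth simp: S_def mult.commute)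
    then show ?thesis
      by (rule has_derivative_eq_rhs)
        (simp add: fun_eq_iff Re_div sgn_div_norm inner_commute power2_eq_square field_simps)
  qed
  have second: "second_deriv (\<lambda>z. ln (norm (?l z))) z a b = Re (- (?L b * ?L a) / (?l z)\<^sup>2)" for a b
  proof (rule second_deriv_eqI[OF S z first])
    show "((\<lambda>x. Re (?L b / ?l x)) has_derivative (\<lambda>a. Re (- (?L b * ?L a) / (?l z)\<^sup>2))) (at z)"
      using nz by (auto intro!: derivative_eq_intros has_derivative_affine_lift_nth
          simp: fun_eq_iff power2_eq_square field_simps)
  qed
  have "Ck_on 2 S (\<lambda>z. ln (norm (?l z)))"
    by (intro Ck_on_ln_norm_affine_lift_nth S) (simp add: S_def)
  from ddc_eq_second_deriv[OF S z this] show ?thesis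
    by (simp add: second affine_lift_linear_scale mult_ac)
qed

section \<open>Local potentials on projective space\<close>

lemma proportional_rep_proj_pt:
  "Z \<noteq> 0 \<Longrightarrow> proportional (homogeneous_rep (proj_pt Z)) Z"
  by (rule Quotient3_rep_abs[OF Quotient3_cproj]) (auto simp: proportional_def intro!: exI[of _ 1])

lemma proj_pt_rep: "proj_pt (homogeneous_rep P) = P"
  by (rule Quotient3_abs_rep[OF Quotient3_cproj])

lemma rep_nonzero: "homogeneous_rep P \<noteq> 0"
  using Quotient3_rep_reflp[OF Quotient3_cproj, of P] by (simp add: proportional_def)

lemma open_chart_vimage:
  assumes "open U"
  shows "open (chart k -` U)"
proof -
  have "open (affine_lift k -` {Z. Z \<noteq> 0 \<and> proj_pt Z \<in> U})"
    using assms by (intro open_vimage continuous_on_affine_lift) (simp add: open_cproj_def)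
  also have "affine_lift k -` {Z. Z \<noteq> 0 \<and> proj_pt Z \<in> U} = chart k -` U"
    by (auto simp: chart_def)
  finally show ?thesis .
qed

definition coord_nonzero :: "'n option \<Rightarrow> 'n::finite cproj set" where
  "coord_nonzero j = {P. homogeneous_rep P $ j \<noteq> 0}"

text \<open>
  The potential \<open>log (|Z| / |Z\<^sub>j|)\<close> of the Fubini--Study form on the domain where \<open>Z\<^sub>j\<close> does not vanish.
  The quotient makes the value independent of the chosen representative.
\<close>

definition fs_potential :: "'n option \<Rightarrow> 'n::finite cproj \<Rightarrow> real" where
  "fs_potential j P = ln (norm (homogeneous_rep P)) - ln (norm (homogeneous_rep P $ j))"

lemma proj_pt_in_coord_nonzero: "Z \<noteq> 0 \<Longrightarrow> proj_pt Z \<in> coord_nonzero j \<longleftrightarrow> Z $ j \<noteq> 0"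
proof -
  assume "Z \<noteq> 0"
  then obtain c where c: "c \<noteq> 0" "Z = c *s homogeneous_rep (proj_pt Z)"
    using proportional_rep_proj_pt[of Z] by (auto simp: proportional_def)
  have "Z $ j = c * homogeneous_rep (proj_pt Z) $ j"
    using arg_cong[OF c(2), of "\<lambda>x. x $ j"] by simp
  then show ?thesis using c(1) by (simp add: coord_nonzero_def)
qed

lemma fs_potential_proj_pt:
  assumes Z: "Z $ j \<noteq> 0"
  shows "fs_potential j (proj_pt Z) = ln (norm Z) - ln (norm (Z $ j))"
proof -
  let ?R = "homogeneous_rep (proj_pt Z)"
  have "Z \<noteq> 0" using Z by auto
  then obtain c where c: "c \<noteq> 0" "Z = c *s ?R" "?R \<noteq> 0"
    using proportional_rep_proj_pt[of Z] by (auto simp: proportional_def)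
  have "norm Z = norm c * norm ?R"
    by (subst c(2)) (simp add: norm_vec_def L2_set_def norm_mult power_mult_distrib
        real_sqrt_mult flip: sum_distrib_left)
  moreover have "norm (Z $ j) = norm c * norm (?R $ j)"
    by (subst c(2)) (simp add: norm_mult)
  moreover have "?R $ j \<noteq> 0"
    using Z by (subst (asm) c(2)) simp
  ultimately show ?thesis
    using c by (simp add: fs_potential_def ln_mult)
qed

lemma open_coord_nonzero: "open (coord_nonzero j)"
proof -
  have "Z \<noteq> 0 \<and> proj_pt Z \<in> coord_nonzero j \<longleftrightarrow> Z $ j \<noteq> 0" for Z
    by (cases "Z = 0") (auto simp: proj_pt_in_coord_nonzero)
  moreover have "open {Z :: complex ^ ('a option). Z $ j \<noteq> 0}"
    by (intro open_Collect_neq continuous_intros)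
  ultimately show ?thesis by (simp add: open_cproj_def)
qed

lemma chart_in_coord_nonzero: "chart k z \<in> coord_nonzero j \<longleftrightarrow> affine_lift k z $ j \<noteq> 0"
  by (simp add: chart_def proj_pt_in_coord_nonzero)

lemma fs_potential_chart:
  "chart k z \<in> coord_nonzero j \<Longrightarrow>
    fs_potential j (chart k z) = ln (norm (affine_lift k z)) - ln (norm (affine_lift k z $ j))"
  unfolding chart_in_coord_nonzero by (simp add: chart_def fs_potential_proj_pt)

lemma Ck_on_fs_potential_chart:
  "Ck_on m (chart k -` coord_nonzero j)
    (\<lambda>z. ln (norm (affine_lift k z)) - ln (norm (affine_lift k z $ j)))"
  by (intro Ck_on_diff Ck_on_ln_norm_affine_lift Ck_on_ln_norm_affine_lift_nth
      open_chart_vimage open_coord_nonzero) (simp add: chart_in_coord_nonzero)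

lemma cproj_smooth_on_fs_potential: "cproj_smooth_on (coord_nonzero j) (fs_potential j)"
  unfolding cproj_smooth_on_def smooth_on_def
  by (auto intro!: Ck_on_cong[OF open_chart_vimage[OF open_coord_nonzero] _ Ck_on_fs_potential_chart]
      simp: fs_potential_chart)

lemma ddc_fs_potential: "ddc_eq_fubini_study_on (coord_nonzero j) (fs_potential j)"
  unfolding ddc_eq_fubini_study_on_def
proof (intro allI ballI)
  fix k z assume z: "z \<in> chart k -` coord_nonzero j"
  have S: "open (chart k -` coord_nonzero j :: (complex ^ 'a) set)"
    by (intro open_chart_vimage open_coord_nonzero)
  have "ddc (fs_potential j \<circ> chart k) z =
      ddc (\<lambda>z. ln (norm (affine_lift k z)) - ln (norm (affine_lift k z $ j))) z"
    by (rule ddc_cong_open[OF S z Ck_on_fs_potential_chart, symmetric]) (simp add: fs_potential_chart)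
  also have "\<dots> = fubini_study k z"
  proof (intro ext)
    fix v w
    show "ddc (\<lambda>z. ln (norm (affine_lift k z)) - ln (norm (affine_lift k z $ j))) z v w =
        fubini_study k z v w"
      using z by (subst ddc_diff[OF S z])
        (auto simp: fubini_study_def ddc_ln_norm_affine_lift_nth chart_in_coord_nonzero
          intro!: Ck_on_ln_norm_affine_lift Ck_on_ln_norm_affine_lift_nth S)
  qed
  finally show "ddc (fs_potential j \<circ> chart k) z = fubini_study k z" .
qed

section \<open>\<open>\<omega>\<close>-plurisubharmonic functions\<close>

text \<open>
  The constant 0 is \<open>\<omega>\<close>-plurisubharmonic. This is what allows an \<open>\<omega>\<close>-plurisubharmonic function to be
  multiplied by a factor in \<open>[0, 1]\<close>, as the missing share of the potential is then itself
  plurisubharmonic.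
\<close>

lemma potential_psh:
  assumes "open U" "cproj_smooth_on U \<psi>" "ddc_eq_fubini_study_on U \<psi>"
  shows "cproj_psh_on U (\<lambda>Z. ereal (\<psi> Z))"
  unfolding cproj_psh_on_def
proof
  fix k
  have "psh_on (chart k -` U) (\<lambda>z. ereal ((\<psi> \<circ> chart k) z))"
  proof (rule psh_on_ddc_nonneg[of _ "\<psi> \<circ> chart k"])
    show "Ck_on 2 (chart k -` U) (\<psi> \<circ> chart k)"
      using assms(2) unfolding cproj_smooth_on_def smooth_on_def by blast
    show "0 \<le> Re (ddc (\<psi> \<circ> chart k) z b (\<i> *s b))" if "z \<in> chart k -` U" for z b
      using assms(3) that fubini_study_nonneg[of k z b] unfolding ddc_eq_fubini_study_on_def by metis
  qed (rule open_chart_vimage[OF assms(1)])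
  then show "psh_on (chart k -` U) ((\<lambda>Z. ereal (\<psi> Z)) \<circ> chart k)"
    by (simp add: o_def)
qed

lemma PSH_omega_not_infty: "\<phi> \<in> PSH_omega \<Longrightarrow> \<phi> Z \<noteq> \<infinity>"
  by (simp add: PSH_omega_def)

lemma PSH_omega_psh_on:
  assumes "\<phi> \<in> PSH_omega" "open U" "cproj_smooth_on U \<psi>" "ddc_eq_fubini_study_on U \<psi>"
  shows "psh_on (chart k -` U) (\<lambda>z. \<phi> (chart k z) + ereal (\<psi> (chart k z)))"
proof -
  have "cproj_psh_on U (\<lambda>Z. \<phi> Z + ereal (\<psi> Z))"
    using assms by (simp add: PSH_omega_def)
  then show ?thesis by (simp add: cproj_psh_on_def o_def)
qed

lemma PSH_omegaI:
  assumes "\<And>Z. \<phi> Z \<noteq> \<infinity>"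
    and "\<And>U \<psi> k. open U \<Longrightarrow> cproj_smooth_on U \<psi> \<Longrightarrow> ddc_eq_fubini_study_on U \<psi> \<Longrightarrow>
      psh_on (chart k -` U) (\<lambda>z. \<phi> (chart k z) + ereal (\<psi> (chart k z)))"
  shows "\<phi> \<in> PSH_omega"
  using assms by (simp add: PSH_omega_def cproj_psh_on_def o_def)

lemma PSH_omega_add_const:
  assumes \<phi>: "\<phi> \<in> PSH_omega"
  shows "(\<lambda>Z. \<phi> Z + ereal b) \<in> PSH_omega"
proof (rule PSH_omegaI)
  fix U :: "'a cproj set" and \<psi> k
  assume U: "open U" "cproj_smooth_on U \<psi>" "ddc_eq_fubini_study_on U \<psi>"
  have "psh_on (chart k -` U) (\<lambda>z. (\<phi> (chart k z) + ereal (\<psi> (chart k z))) + ereal b)"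
    by (intro psh_on_add psh_on_const PSH_omega_psh_on[OF \<phi> U]) simp
  then show "psh_on (chart k -` U) (\<lambda>z. \<phi> (chart k z) + ereal b + ereal (\<psi> (chart k z)))"
    by (simp only: add.assoc add.commute[of "ereal b"])
qed (use PSH_omega_not_infty[OF \<phi>] in simp)

text \<open>
  With \<open>s\<close> the sum of the weights,
  \<open>(\<Sum>k<N. c\<^sub>k \<phi>\<^sub>k) + \<psi> = (\<Sum>k<N. c\<^sub>k (\<phi>\<^sub>k + \<psi>)) + (1 - s) \<psi>\<close>.
\<close>

lemma PSH_omega_subconvex_sum:
  fixes \<phi> :: "nat \<Rightarrow> 'n::finite cproj \<Rightarrow> ereal"
  assumes \<phi>: "\<And>k. \<phi> k \<in> PSH_omega" and c: "\<And>k. c k \<ge> 0" and le1: "(\<Sum>k<N. c k) \<le> 1"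
  shows "(\<lambda>Z. \<Sum>k<N. ereal (c k) * \<phi> k Z) \<in> PSH_omega"
proof (rule PSH_omegaI)
  have "ereal (c k) * \<phi> k Z \<noteq> \<infinity>" for k Z
    using PSH_omega_not_infty[OF \<phi>, of k Z] c[of k] by (cases "\<phi> k Z") auto
  then show "(\<Sum>k<N. ereal (c k) * \<phi> k Z) \<noteq> \<infinity>" for Z
    by (simp add: sum_Pinfty)
  fix U :: "'n cproj set" and \<psi> j
  assume U: "open U" "cproj_smooth_on U \<psi>" "ddc_eq_fubini_study_on U \<psi>"
  have psi: "psh_on (chart j -` U) (\<lambda>z. ereal (\<psi> (chart j z)))"
    using potential_psh[OF U] by (simp add: cproj_psh_on_def o_def)
  have partial: "psh_on (chart j -` U)
      (\<lambda>z. (\<Sum>k<M. ereal (c k) * \<phi> k (chart j z)) + ereal ((\<Sum>k<M. c k) * \<psi> (chart j z)))" for M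
  proof (induction M)
    case 0
    then show ?case using psh_on_const[of 0] by (simp flip: zero_ereal_def)
  next
    case (Suc M)
    have step: "(\<Sum>k<Suc M. ereal (c k) * \<phi> k Z) + ereal ((\<Sum>k<Suc M. c k) * \<psi> Z) =
        ((\<Sum>k<M. ereal (c k) * \<phi> k Z) + ereal ((\<Sum>k<M. c k) * \<psi> Z))
          + ereal (c M) * (\<phi> M Z + ereal (\<psi> Z))" for Z
    proof -
      have "ereal (c M) * (\<phi> M Z + ereal (\<psi> Z)) = ereal (c M) * \<phi> M Z + ereal (c M * \<psi> Z)"
        using PSH_omega_not_infty[OF \<phi>, of M Z] c[of M]
        by (cases "\<phi> M Z"; cases "c M = 0") (auto simp: distrib_left simp flip: zero_ereal_def)
      moreover have "ereal ((\<Sum>k<Suc M. c k) * \<psi> Z) = ereal ((\<Sum>k<M. c k) * \<psi> Z) + ereal (c M * \<psi> Z)"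
        by (simp add: distrib_right)
      ultimately show ?thesis by (simp only: sum.lessThan_Suc) (simp only: ac_simps)
    qed
    show ?case
      unfolding step by (intro psh_on_add Suc.IH psh_on_mult PSH_omega_psh_on[OF \<phi> U] c)
  qed
  have "psh_on (chart j -` U) (\<lambda>z. ((\<Sum>k<N. ereal (c k) * \<phi> k (chart j z)) +
      ereal ((\<Sum>k<N. c k) * \<psi> (chart j z))) + ereal (1 - (\<Sum>k<N. c k)) * ereal (\<psi> (chart j z)))"
    using le1 by (intro psh_on_add partial psh_on_mult psi) simp
  moreover have "(x + ereal (s * y)) + ereal (1 - s) * ereal y = x + ereal y" for x s y
    by (cases x) (auto simp: algebra_simps)
  ultimately show "psh_on (chart j -` U)
      (\<lambda>z. (\<Sum>k<N. ereal (c k) * \<phi> k (chart j z)) + ereal (\<psi> (chart j z)))"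
    by simp
qed

lemma PSH_omega_scale:
  assumes "\<phi> \<in> PSH_omega" "0 \<le> t" "t \<le> 1"
  shows "(\<lambda>Z. ereal t * \<phi> Z) \<in> PSH_omega"
  using PSH_omega_subconvex_sum[of "\<lambda>_. \<phi>" "\<lambda>_. t" 1] assms by simp

lemma PSH_omega_INF:
  fixes \<phi> :: "nat \<Rightarrow> 'n::finite cproj \<Rightarrow> ereal"
  assumes \<phi>: "\<And>k. \<phi> k \<in> PSH_omega" and dec: "\<And>Z. decseq (\<lambda>k. \<phi> k Z)"
  shows "(\<lambda>Z. INF k. \<phi> k Z) \<in> PSH_omega"
proof (rule PSH_omegaI)
  show "(INF k. \<phi> k Z) \<noteq> \<infinity>" for Z
    using PSH_omega_not_infty[OF \<phi>, of 0 Z] INF_lower[of 0 UNIV "\<lambda>k. \<phi> k Z"] by auto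
  fix U :: "'n cproj set" and \<psi> j
  assume U: "open U" "cproj_smooth_on U \<psi>" "ddc_eq_fubini_study_on U \<psi>"
  have "psh_on (chart j -` U) (\<lambda>z. INF k. \<phi> k (chart j z) + ereal (\<psi> (chart j z)))"
    by (intro psh_on_INF PSH_omega_psh_on[OF \<phi> U])
      (use dec in \<open>auto simp: decseq_def intro!: add_right_mono\<close>)
  also have "(\<lambda>z. INF k. \<phi> k (chart j z) + ereal (\<psi> (chart j z))) =
      (\<lambda>z. (INF k. \<phi> k (chart j z)) + ereal (\<psi> (chart j z)))"
    using dec PSH_omega_not_infty[OF \<phi>] by (intro ext) (subst INF_ereal_add, auto)
  finally show "psh_on (chart j -` U) (\<lambda>z. (INF k. \<phi> k (chart j z)) + ereal (\<psi> (chart j z)))" .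
qed

definition closed_polydisc :: "(complex ^ 'n::finite) set" where
  "closed_polydisc = {z. \<forall>k. norm (z $ k) \<le> 1}"

lemma compact_closed_polydisc: "compact (closed_polydisc :: (complex ^ 'n::finite) set)"
proof -
  have "closed (closed_polydisc :: (complex ^ 'n) set)"
    unfolding closed_polydisc_def
    by (intro closed_Collect_all closed_Collect_le continuous_intros)
  moreover have "norm z \<le> CARD('n)" if "z \<in> closed_polydisc" for z :: "complex ^ 'n"
  proof -
    have "norm z \<le> (\<Sum>k\<in>UNIV. norm (z $ k))"
      unfolding norm_vec_def by (rule L2_set_le_sum) simp
    also have "\<dots> \<le> (\<Sum>k\<in>(UNIV :: 'n set). 1)"
      using that by (intro sum_mono) (simp add: closed_polydisc_def)
    finally show ?thesis by simp
  qed
  then have "bounded (closed_polydisc :: (complex ^ 'n) set)"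
    unfolding bounded_iff by blast
  ultimately show ?thesis by (simp add: compact_eq_bounded_closed)
qed

text \<open>
  Normalize a representative by a coordinate of maximal modulus.
\<close>

lemma polydiscs_cover:
  fixes P :: "'n::finite cproj"
  obtains j z where "z \<in> closed_polydisc" "P = chart j z"
proof -
  let ?Z = "homogeneous_rep P"
  have "Max (range (\<lambda>i. norm (?Z $ i))) \<in> range (\<lambda>i. norm (?Z $ i))"
    by (intro Max_in) auto
  then obtain j where j: "Max (range (\<lambda>i. norm (?Z $ i))) = norm (?Z $ j)" by (rule imageE)
  have max: "norm (?Z $ i) \<le> norm (?Z $ j)" for i
    unfolding j[symmetric] by (intro Max_ge) auto
  have nz: "?Z $ j \<noteq> 0"
  proof
    assume "?Z $ j = 0"
    then have "?Z = 0" using max by (simp add: vec_eq_iff)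
    then show False using rep_nonzero by blast
  qed
  define z :: "complex ^ 'n" where
    "z = (\<chi> k. (if j = Some k then ?Z $ None else ?Z $ Some k) / ?Z $ j)"
  have "?Z = ?Z $ j *s affine_lift j z"
  proof (subst vec_eq_iff, rule allI)
    fix i
    show "?Z $ i = (?Z $ j *s affine_lift j z) $ i"
      using nz by (cases i; cases j) (auto simp: affine_lift_def z_def)
  qed
  then have "proportional (affine_lift j z) ?Z"
    using nz rep_nonzero[of P] by (auto simp: proportional_def)
  then have "P = chart j z"
    using Quotient3_rel_abs[OF Quotient3_cproj] by (metis chart_def proj_pt_rep)
  moreover have "z \<in> closed_polydisc"
    using max nz by (auto simp: closed_polydisc_def z_def norm_divide)
  ultimately show thesis by (rule that[rotated])
qed

text \<open>
  On the chart \<open>j\<close> the function \<open>\<phi>\<close> plus the local potential is upper semicontinuous, hence bounded above on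
  the compact polydisc, and the potential is nonnegative there. The finitely many polydiscs cover
  the projective space.
\<close>

lemma PSH_omega_bounded_above:
  fixes \<phi> :: "'n::finite cproj \<Rightarrow> ereal"
  assumes \<phi>: "\<phi> \<in> PSH_omega"
  obtains C :: real where "\<And>Z. \<phi> Z \<le> ereal C"
proof -
  have "\<exists>C. \<forall>z\<in>closed_polydisc. \<phi> (chart j z) \<le> ereal C" for j
  proof -
    let ?u = "\<lambda>z. \<phi> (chart j z) + ereal (fs_potential j (chart j z))"
    have "chart j -` coord_nonzero j = (UNIV :: (complex ^ 'n) set)"
      by (auto simp: chart_in_coord_nonzero)
    then have "psh_on UNIV ?u"
      using PSH_omega_psh_on[OF \<phi> open_coord_nonzero cproj_smooth_on_fs_potential ddc_fs_potential, of j j]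
      by simp
    then have "usc_on UNIV ?u" "\<And>z. z \<in> UNIV \<Longrightarrow> ?u z \<noteq> \<infinity>"
      by (simp_all only: psh_on_def) blast
    from usc_on_bounded_above[OF this compact_closed_polydisc subset_UNIV]
    obtain C where C: "\<And>z. z \<in> closed_polydisc \<Longrightarrow> ?u z \<le> ereal C" by blast
    have "\<phi> (chart j z) \<le> ereal C" if "z \<in> closed_polydisc" for z
    proof -
      have "norm (affine_lift j z) \<ge> 1"
        using Finite_Cartesian_Product.norm_nth_le[of "affine_lift j z" j] by simp
      then have "fs_potential j (chart j z) \<ge> 0"
        by (simp add: fs_potential_chart chart_in_coord_nonzero)
      then have "\<phi> (chart j z) \<le> ?u z"
        by (cases "\<phi> (chart j z)") auto
      then show ?thesis using C[OF that] by (rule order_trans)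
    qed
    then show ?thesis by blast
  qed
  then obtain C where C: "\<And>j z. z \<in> closed_polydisc \<Longrightarrow> \<phi> (chart j z) \<le> ereal (C j)"
    by metis
  have "\<phi> Z \<le> ereal (Max (range C))" for Z
  proof (rule polydiscs_cover[of Z])
    fix j z assume "z \<in> closed_polydisc" "Z = chart j z"
    then have "\<phi> Z \<le> ereal (C j)" using C by simp
    also have "\<dots> \<le> ereal (Max (range C))" by simp
    finally show ?thesis .
  qed
  then show thesis by (rule that)
qed

section \<open>The extremal function and the pluripolar hull\<close>

lemma extremal_sigma_le_0:
  assumes "s > 0"
  shows "extremal_sigma Z s E \<le> 0"
  unfolding extremal_sigma_def
proof (rule SUP_least)
  fix \<phi> assume "\<phi> \<in> {\<phi> \<in> PSH_omega. \<forall>W. \<phi> W \<le> ereal (- s * indicator E W)}"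
  then have "\<phi> Z \<le> ereal (- s * indicator E Z)" by blast
  also have "\<dots> \<le> 0" using assms by (simp add: indicator_def)
  finally show "\<phi> Z \<le> 0" .
qed

text \<open>
  Subtracting a constant makes \<open>\<phi>\<close> nonpositive. It is \<open>-\<infinity>\<close> on \<open>E\<close>, so every multiple \<open>t \<phi>\<close> with
  \<open>0 < t \<le> 1\<close> competes in the definition of the extremal function for every \<open>s\<close>, and \<open>t \<phi> Z\<close> tends to 0
  with \<open>t\<close>.
\<close>

lemma extremal_sigma_eq_0:
  assumes \<phi>: "\<phi> \<in> PSH_omega" "\<And>W. W \<in> E \<Longrightarrow> \<phi> W = -\<infinity>" and Z: "\<phi> Z \<noteq> -\<infinity>" and s: "s > 0"
  shows "extremal_sigma Z s E = 0"
proof (rule antisym[OF extremal_sigma_le_0[OF s]])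
  obtain C where C: "\<And>W. \<phi> W \<le> ereal C" using PSH_omega_bounded_above[OF \<phi>(1)] by blast
  obtain x where x: "\<phi> Z = ereal x"
    using Z PSH_omega_not_infty[OF \<phi>(1), of Z] by (cases "\<phi> Z") auto
  define m where "m = C - x"
  have m: "m \<ge> 0" using C[of Z] x by (simp add: m_def)
  show "0 \<le> extremal_sigma Z s E"
  proof (rule ereal_le_epsilon2)
    fix \<delta> :: real assume \<delta>: "\<delta> > 0"
    \<comment> \<open>\<open>m + 1\<close> instead of \<open>m\<close> because \<open>m\<close> may be 0\<close>
    define t where "t = min 1 (\<delta> / (m + 1))"
    have t: "0 < t" "t \<le> 1" "t * m \<le> \<delta>"
    proof -
      have "t * m \<le> \<delta> / (m + 1) * m" using m by (intro mult_right_mono) (auto simp: t_def)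
      also have "\<dots> \<le> \<delta>" using m \<delta> by (simp add: field_simps)
      finally show "t * m \<le> \<delta>" .
    qed (use m \<delta> in \<open>auto simp: t_def\<close>)
    let ?\<chi> = "\<lambda>W. ereal t * (\<phi> W + ereal (- C))"
    have "?\<chi> \<in> PSH_omega"
      using t by (intro PSH_omega_scale PSH_omega_add_const \<phi>) auto
    moreover have "?\<chi> W \<le> ereal (- s * indicator E W)" for W
    proof (cases "W \<in> E")
      case True
      then show ?thesis using \<phi>(2) t by simp
    next
      case False
      then show ?thesis
        using C[of W] t by (cases "\<phi> W") (auto simp: mult_le_0_iff)
    qed
    ultimately have "?\<chi> Z \<le> extremal_sigma Z s E"
      unfolding extremal_sigma_def by (intro SUP_upper) auto
    moreover have "?\<chi> Z = ereal (- (t * m))" using x by (simp add: m_def algebra_simps)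
    moreover have "ereal (- \<delta>) \<le> ereal (- (t * m))" using t(3) by simp
    ultimately have "ereal (- \<delta>) \<le> extremal_sigma Z s E" by (metis order_trans)
    then show "0 \<le> extremal_sigma Z s E + ereal \<delta>"
      by (cases "extremal_sigma Z s E") auto
  qed
qed

text \<open>
  For \<open>s = 2\<^sup>k\<^sup>+\<^sup>1\<close> there is a competitor \<open>\<phi>\<^sub>k\<close> with \<open>\<phi>\<^sub>k Z > -1\<close>. In the series of the \<open>2\<^sup>-\<^sup>k\<^sup>-\<^sup>1 \<phi>\<^sub>k\<close> each term
  is at most \<open>-1\<close> on \<open>E\<close>, while the series is at least \<open>-1\<close> at \<open>Z\<close>. The terms are nonpositive, so the
  partial sums decrease and the sum is \<open>\<omega>\<close>-plurisubharmonic.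
\<close>

lemma separating_PSH_omega:
  assumes \<sigma>: "\<And>s. s > 0 \<Longrightarrow> extremal_sigma Z s E = 0"
  obtains \<Phi> where "\<Phi> \<in> PSH_omega" "\<And>W. W \<in> E \<Longrightarrow> \<Phi> W = -\<infinity>" "\<Phi> Z \<noteq> -\<infinity>"
proof -
  have "\<exists>\<phi>\<in>PSH_omega. (\<forall>W. \<phi> W \<le> ereal (- (2 ^ Suc k) * indicator E W)) \<and> ereal (- 1) < \<phi> Z" for k
  proof -
    have "ereal (- 1) < extremal_sigma Z (2 ^ Suc k) E" using \<sigma> by simp
    then show ?thesis unfolding extremal_sigma_def less_SUP_iff by blast
  qed
  then obtain \<phi> where \<phi>: "\<And>k. \<phi> k \<in> PSH_omega"
    and le: "\<And>k W. \<phi> k W \<le> ereal (- (2 ^ Suc k) * indicator E W)"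
    and gt: "\<And>k. ereal (- 1) < \<phi> k Z"
    by metis
  have nonpos: "\<phi> k W \<le> 0" for k W
    using le[of k W] by (rule order_trans) (simp add: indicator_def)
  define c :: "nat \<Rightarrow> real" where "c k = 1 / 2 ^ Suc k" for k
  define S where "S N W = (\<Sum>k<N. ereal (c k) * \<phi> k W)" for N W
  have c: "c k > 0" for k by (simp add: c_def)
  have sum_c: "(\<Sum>k<N. c k) = 1 - 1 / 2 ^ N" for N
    by (induction N) (auto simp: c_def field_simps)
  have dec: "decseq (\<lambda>N. S N W)" for W
  proof (rule decseq_SucI)
    fix N
    have "ereal (c N) * \<phi> N W \<le> 0" using c[of N] nonpos[of N W] by (simp add: ereal_mult_le_0_iff)
    then show "S (Suc N) W \<le> S N W"
      using add_left_mono[of "ereal (c N) * \<phi> N W" 0 "S N W"] by (simp add: S_def)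
  qed
  show thesis
  proof
    show "(\<lambda>W. INF N. S N W) \<in> PSH_omega"
      unfolding S_def[abs_def]
      by (intro PSH_omega_INF PSH_omega_subconvex_sum \<phi> less_imp_le[OF c])
        (use dec in \<open>simp_all add: sum_c S_def[abs_def]\<close>)
  next
    fix W assume W: "W \<in> E"
    have "S N W \<le> ereal (- real N)" for N
    proof (induction N)
      case (Suc N)
      have "ereal (c N) * \<phi> N W \<le> ereal (c N) * ereal (- (2 ^ Suc N))"
        using le[of N W] W c[of N] by (intro ereal_mult_left_mono) auto
      also have "\<dots> = ereal (- 1)" by (simp add: c_def)
      finally have "S N W + ereal (c N) * \<phi> N W \<le> ereal (- real N) + ereal (- 1)"
        by (intro add_mono Suc.IH)
      then show ?case by (simp add: S_def algebra_simps)
    qed (simp add: S_def)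
    then have bound: "(INF N. S N W) \<le> ereal (- real N)" for N
      by (meson INF_lower UNIV_I order_trans)
    show "(INF N. S N W) = -\<infinity>"
    proof (rule ereal_bot)
      fix B :: real
      obtain N :: nat where "- B \<le> N" using real_arch_simple by blast
      then have "ereal (- real N) \<le> ereal B" by simp
      then show "(INF N. S N W) \<le> ereal B" using bound[of N] order_trans by blast
    qed
  next
    have "ereal (- (\<Sum>k<N. c k)) \<le> S N Z" for N
    proof (induction N)
      case (Suc N)
      have "ereal (c N) * ereal (- 1) \<le> ereal (c N) * \<phi> N Z"
        using gt[of N] c[of N] by (intro ereal_mult_left_mono) auto
      then have "ereal (- (\<Sum>k<N. c k)) + ereal (- c N) \<le> S N Z + ereal (c N) * \<phi> N Z"
        using Suc.IH by (intro add_mono) simp_all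
      then show ?case by (simp add: S_def)
    qed (simp add: S_def)
    then have "ereal (- 1) \<le> S N Z" for N
      by (rule order_trans[rotated]) (simp add: sum_c)
    then have "ereal (- 1) \<le> (INF N. S N Z)" by (intro INF_greatest)
    then show "(INF N. S N Z) \<noteq> -\<infinity>" by auto
  qed
qed

theorem theorem2p19:
  fixes E :: "'n::finite cproj set"
  assumes "pluripolar E"
  shows "{Z. \<forall>s::real. s > 0 \<longrightarrow> extremal_sigma Z s E = 0} = - pluripolar_hull E"
proof (intro equalityI subsetI)
  fix Z assume "Z \<in> {Z. \<forall>s::real. s > 0 \<longrightarrow> extremal_sigma Z s E = 0}"
  then obtain \<Phi> where "\<Phi> \<in> PSH_omega" "\<And>W. W \<in> E \<Longrightarrow> \<Phi> W = -\<infinity>" "\<Phi> Z \<noteq> -\<infinity>"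
    using separating_PSH_omega[of Z E] by auto
  then show "Z \<in> - pluripolar_hull E" by (auto simp: pluripolar_hull_def)
next
  fix Z assume "Z \<in> - pluripolar_hull E"
  then obtain \<phi> where "\<phi> \<in> PSH_omega" "\<And>W. W \<in> E \<Longrightarrow> \<phi> W = -\<infinity>" "\<phi> Z \<noteq> -\<infinity>"
    by (auto simp: pluripolar_hull_def)
  then show "Z \<in> {Z. \<forall>s::real. s > 0 \<longrightarrow> extremal_sigma Z s E = 0}"
    using extremal_sigma_eq_0 by blast
qed

end
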